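(* Assume that the ABC Conjecture holds. Let $\epsilon>0$ and let $k$ be a square-free positive integer. If $\gcd(k,3)=1$, then $\vert \mathcal{T}_k\cap [1,N]\vert=O_{\epsilon,k}(N^{(1/3)+\epsilon})$. If $k\geq 2$, then $\vert \mathcal{S}_k\cap [1,N]\vert=O_{\epsilon,k}(N^{(1/3)+\epsilon})$.
   Context: ABC Conjecture: for every $\epsilon>0$ there exists a positive constant $C$ depending only on $\epsilon$ such that for all relatively prime nonzero integers $a,b,c$ with $a+b=c$, we have $\max\{\vert a\vert,\vert b\vert,\vert c\vert\}\leq C\left(\prod_{p\text{ prime},\, p\mid abc}p\right)^{1+\epsilon}$. A number field $K$ is called monogenic if its ring of integers $\mathcal{O}_K$ equals $\mathbb{Z}[\theta]$ for some $\theta\in\mathcal{O}_K$. For each square-free positive integer $k$, let $\mathcal{S}_k$ be the set of square-free integers $m>0$ such that $\gcd(m,k)=1$, $k^2m\not\equiv \pm 1 \pmod 9$, and $\mathbb{Q}(\sqrt[3]{k^2m})$ is monogenic. For each square-free positive integer $k$ with $\gcd(k,3)=1$, let $\mathcal{T}_k$ be the set of square-free integers $m>0$ such that $\gcd(m,k)=1$, $k^2m\equiv \pm 1 \pmod 9$, and $\mathbb{Q}(\sqrt[3]{k^2m})$ is monogenic. The notation $O_{\epsilon,k}$ means the implied constant depends only on $\epsilon$ and $k$; $N$ ranges over positive integers. *)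

theory Defs
  imports
    "HOL-Algebra.Algebraic_Closure_Type"
    "HOL-Algebra.Generated_Fields"
    "HOL-Computational_Algebra.Computational_Algebra"
    "HOL-Number_Theory.Cong"
    Complex_Main
begin

(* HOL-Algebra reuses the name "prime", so Factorial_Ring.prime is qualified throughout.
   Primes of type int are positive. *)

definition abc_conjecture :: bool where
  "abc_conjecture \<longleftrightarrow>
     (\<forall>\<epsilon>::real. \<epsilon> > 0 \<longrightarrow>
       (\<exists>C::real. C > 0 \<and>
         (\<forall>a b c :: int. a \<noteq> 0 \<and> b \<noteq> 0 \<and> c \<noteq> 0 \<and> Gcd {a, b, c} = 1 \<and> a + b = c \<longrightarrow>
            real_of_int (Max {\<bar>a\<bar>, \<bar>b\<bar>, \<bar>c\<bar>})
              \<le> C * real_of_int (\<Prod>p | Factorial_Ring.prime p \<and> p dvd a * b * c. p) powr (1 + \<epsilon>))))"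

(* Number fields are taken inside the complex numbers, viewed as a HOL-Algebra ring. *)

abbreviation complex_ring :: "complex ring" where
  "complex_ring \<equiv> ring_of_type_algebra"

(* Subfields of the complex numbers contain the rationals, so the field generated by {\<alpha>}
   is Q(\<alpha>); likewise the ring (with one) generated by {\<theta>} is Z[\<theta>]. *)

definition rat_adjoin :: "complex \<Rightarrow> complex set" where
  "rat_adjoin \<alpha> = generate_field complex_ring {\<alpha>}"

definition int_adjoin :: "complex \<Rightarrow> complex set" where
  "int_adjoin \<theta> = generate_ring complex_ring {\<theta>}"

definition ring_of_integers :: "complex set \<Rightarrow> complex set" where
  "ring_of_integers K = {x \<in> K. algebraic_int x}"

(* Only meaningful when K is a number field; it is applied below to pure cubic fields
   (and to Q itself, when k = m = 1). *)

definition monogenic :: "complex set \<Rightarrow> bool" where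
  "monogenic K \<longleftrightarrow> (\<exists>\<theta> \<in> ring_of_integers K. ring_of_integers K = int_adjoin \<theta>)"

definition pure_cubic_field :: "nat \<Rightarrow> complex set" where
  "pure_cubic_field n = rat_adjoin (complex_of_real (root 3 (real n)))"

definition S_set :: "nat \<Rightarrow> nat set" where
  "S_set k = {m. m > 0 \<and> squarefree m \<and> coprime m k \<and>
                 \<not> ([int (k\<^sup>2 * m) = 1] (mod 9) \<or> [int (k\<^sup>2 * m) = -1] (mod 9)) \<and>
                 monogenic (pure_cubic_field (k\<^sup>2 * m))}"

definition T_set :: "nat \<Rightarrow> nat set" where
  "T_set k = {m. m > 0 \<and> squarefree m \<and> coprime m k \<and>
                 ([int (k\<^sup>2 * m) = 1] (mod 9) \<or> [int (k\<^sup>2 * m) = -1] (mod 9)) \<and>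
                 monogenic (pure_cubic_field (k\<^sup>2 * m))}"

end

theory Submission
  imports Defs
begin

text \<open>
  Put \<open>A = (k\<^sup>2 m)\<^sup>1\<^sup>/\<^sup>3\<close> and \<open>B = (k m\<^sup>2)\<^sup>1\<^sup>/\<^sup>3\<close>, so that \<open>A\<^sup>2 = k B\<close>, \<open>A B = k m\<close>, \<open>B\<^sup>2 = m A\<close>, and \<open>1, A, B\<close>
  is a rational basis of the pure cubic field. Suppose that \<open>\<theta> = r + s A + t B\<close> generates its ring of
  integers. As \<open>A\<close> and \<open>B\<close> are integer combinations of \<open>1, \<theta>, \<theta>\<^sup>2\<close>, comparing determinants gives
  \<open>I (k s\<^sup>3 - m t\<^sup>3) = 1\<close> with an integer \<open>I\<close> (lemma \<open>generator_index_equation\<close>). The denominators of \<open>s\<close>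
  and \<open>t\<close> divide 3 (\<open>generator_denominators\<close>), so a monogenic field yields a solution of
  the Thue equation \<open>k x\<^sup>3 - m y\<^sup>3 = c\<close> for some \<open>c dvd 27\<close> coprime to \<open>m y\<close>. Here \<open>y = 0\<close> would make \<open>c = k x\<^sup>3\<close> a unit,
  so that \<open>k = 1\<close>; and for \<open>k = 1\<close> it is ruled out by an additional integer of the field, which exists because
  \<open>m\<close> is congruent to \<open>1\<close> or \<open>-1\<close> modulo 9 (\<open>generator_B_coordinate_nonzero\<close>).

  Now \<open>|x|\<close> has order at most \<open>m\<^sup>1\<^sup>/\<^sup>3 y\<close>, and the ABC conjecture for \<open>k x\<^sup>3 - m y\<^sup>3 = c\<close> bounds \<open>m y\<^sup>3\<close> by a constant
  times \<open>(k |x| m y)\<close> to the power \<open>1 + \<delta>\<close>; together, \<open>y\<close> is at most a constant times \<open>m\<close> to the power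
  \<open>1/3 + \<epsilon>/2\<close> (\<open>abc_imp_thue_solution_bound\<close>).

  Finally \<open>m\<close> is determined by \<open>(x, y, c)\<close>, so it is enough to count triples. For given coprime \<open>y\<close> and \<open>c\<close> the
  congruence \<open>k x\<^sup>3 = c (mod y\<^sup>3)\<close> has at most \<open>3\<^sup>\<omega>\<close> residue classes of solutions, where \<open>\<omega>\<close> is the number of prime
  divisors of \<open>y\<close>, and \<open>3\<^sup>\<omega>\<close> is smaller than any power of \<open>y\<close>, up to a constant. An interval of length of order
  \<open>N\<^sup>1\<^sup>/\<^sup>3 y\<close> meets each class \<open>O(N\<^sup>1\<^sup>/\<^sup>3 / y\<^sup>2 + 1)\<close> times. Summing over \<open>y\<close> and neglecting
  arbitrarily small powers of \<open>N\<close>, the first term contributes \<open>O(N\<^sup>1\<^sup>/\<^sup>3)\<close> because the sum of the inverse squares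
  converges, and the second as many as there are values of \<open>y\<close>
  (\<open>card_thue_parameters_bound\<close>).
\<close>

section \<open>The norm form of a pure cubic field\<close>

text \<open>
  The norm of \<open>r + s A + t B\<close> down to the rationals, where \<open>A\<close> and \<open>B\<close> are the real cube roots of \<open>a b\<^sup>2\<close>
  and \<open>a\<^sup>2 b\<close>.
\<close>

definition cubic_norm :: "nat \<Rightarrow> nat \<Rightarrow> 'a \<Rightarrow> 'a \<Rightarrow> 'a \<Rightarrow> 'a :: comm_ring_1" where
  "cubic_norm a b r s t = r ^ 3 + of_nat (a * b\<^sup>2) * s ^ 3 + of_nat (a\<^sup>2 * b) * t ^ 3
     - 3 * of_nat (a * b) * (r * s * t)"

lemma cubic_norm_swap: "cubic_norm a b r s t = cubic_norm b a r t s"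
  by (simp add: cubic_norm_def algebra_simps)

lemma cubic_norm_scale: "cubic_norm a b (d * r) (d * s) (d * t) = d ^ 3 * cubic_norm a b r s t"
  by (simp add: cubic_norm_def algebra_simps power3_eq_cube)

lemma of_int_cubic_norm: "of_int (cubic_norm a b r s t) = cubic_norm a b (of_int r) (of_int s) (of_int t)"
  by (simp add: cubic_norm_def)

lemma cubic_norm_mult:
  fixes r s t r' s' t' :: "'a :: comm_ring_1"
  shows "cubic_norm a b (r * r' + of_nat (a * b) * (s * t' + t * s'))
                        (r * s' + s * r' + of_nat a * (t * t'))
                        (r * t' + t * r' + of_nat b * (s * s'))
         = cubic_norm a b r s t * cubic_norm a b r' s' t'"
  unfolding cubic_norm_def of_nat_mult of_nat_power
  by (simp add: algebra_simps power2_eq_square power3_eq_cube)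

lemma prime_not_square_dvd_squarefree:
  fixes n :: nat and p :: int
  assumes "squarefree n" "Factorial_Ring.prime p"
  shows "\<not> p\<^sup>2 dvd int n"
proof
  assume d: "p\<^sup>2 dvd int n"
  have p: "p = int (nat p)" using assms(2) by (simp add: prime_ge_0_int)
  from d have "(nat p)\<^sup>2 dvd n"
    by (subst (asm) p) (metis of_nat_dvd_iff of_nat_power)
  with assms(1) have "nat p dvd 1" by (rule squarefreeD)
  thus False using assms(2) by (metis nat_dvd_1_iff_1 not_prime_1 of_nat_1 p)
qed

text \<open>
  For a prime \<open>p\<close> dividing exactly one of \<open>a\<close> and \<open>b\<close>, and that only once, the terms \<open>u\<^sup>3\<close>, \<open>a b\<^sup>2 x\<^sup>3\<close>, \<open>a\<^sup>2 b y\<^sup>3\<close> have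
  \<open>p\<close>-adic valuations in three different classes modulo 3, and the valuation of the mixed term exceeds the
  smallest of theirs, so nothing cancels. The three divisibilities come out
  one after the other, each after dividing the identity by one more factor \<open>p\<close>.
\<close>

lemma cubic_norm_dvd_prime_left:
  fixes u x y p :: int
  assumes a: "squarefree a" and ab: "coprime a b"
    and p: "Factorial_Ring.prime p" "p dvd int a" and N: "p ^ 3 dvd cubic_norm a b u x y"
  shows "p dvd u \<and> p dvd x \<and> p dvd y"
proof -
  obtain a' where a': "int a = p * a'" using p(2) by auto
  have p0: "p \<noteq> 0" using p(1) by auto
  have "\<not> p\<^sup>2 dvd int a" using prime_not_square_dvd_squarefree[OF a p(1)] .
  hence na: "\<not> p dvd a'" unfolding a' power2_eq_square using p0 by auto
  have nb: "\<not> p dvd int b"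
    using ab p coprime_common_divisor[of "int a" "int b" p] not_prime_unit by auto
  obtain n where n: "cubic_norm a b u x y = p ^ 3 * n" using N by auto
  have eq: "u ^ 3 + p * a' * (int b)\<^sup>2 * x ^ 3 + p\<^sup>2 * a'\<^sup>2 * int b * y ^ 3 - 3 * p * a' * int b * (u * x * y) = p ^ 3 * n"
    using n unfolding cubic_norm_def by (simp add: a' algebra_simps power2_eq_square)
  have "p dvd u ^ 3"
  proof -
    have "u ^ 3 = p * (p\<^sup>2 * n - a' * (int b)\<^sup>2 * x ^ 3 - p * a'\<^sup>2 * int b * y ^ 3 + 3 * a' * int b * (u * x * y))"
      using eq by (simp add: algebra_simps power2_eq_square power3_eq_cube)
    thus ?thesis by simp
  qed
  hence pu: "p dvd u" using p(1) prime_dvd_power by blast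
  then obtain u' where u': "u = p * u'" by auto
  have eq2: "p\<^sup>2 * u' ^ 3 + a' * (int b)\<^sup>2 * x ^ 3 + p * a'\<^sup>2 * int b * y ^ 3 - 3 * p * a' * int b * (u' * x * y) = p\<^sup>2 * n"
  proof -
    have "p * (p\<^sup>2 * u' ^ 3 + a' * (int b)\<^sup>2 * x ^ 3 + p * a'\<^sup>2 * int b * y ^ 3 - 3 * p * a' * int b * (u' * x * y)) = p * (p\<^sup>2 * n)"
      using eq unfolding u' by (simp add: algebra_simps power2_eq_square power3_eq_cube)
    thus ?thesis using p0 by simp
  qed
  have "p dvd a' * (int b)\<^sup>2 * x ^ 3"
  proof -
    have "a' * (int b)\<^sup>2 * x ^ 3 = p * (p * n - p * u' ^ 3 - a'\<^sup>2 * int b * y ^ 3 + 3 * a' * int b * (u' * x * y))"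
      using eq2 by (simp add: algebra_simps power2_eq_square power3_eq_cube)
    thus ?thesis by simp
  qed
  hence px: "p dvd x" using na nb p(1) by (auto simp: prime_dvd_mult_iff prime_dvd_power_iff)
  then obtain x' where x': "x = p * x'" by auto
  have eq3: "p * u' ^ 3 + p\<^sup>2 * a' * (int b)\<^sup>2 * x' ^ 3 + a'\<^sup>2 * int b * y ^ 3 - 3 * p * a' * int b * (u' * x' * y) = p * n"
  proof -
    have "p * (p * u' ^ 3 + p\<^sup>2 * a' * (int b)\<^sup>2 * x' ^ 3 + a'\<^sup>2 * int b * y ^ 3 - 3 * p * a' * int b * (u' * x' * y)) = p * (p * n)"
      using eq2 unfolding x' by (simp add: algebra_simps power2_eq_square power3_eq_cube)
    thus ?thesis using p0 by simp
  qed
  have "p dvd a'\<^sup>2 * int b * y ^ 3"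
  proof -
    have "a'\<^sup>2 * int b * y ^ 3 = p * (n - u' ^ 3 - p * a' * (int b)\<^sup>2 * x' ^ 3 + 3 * a' * int b * (u' * x' * y))"
      using eq3 by (simp add: algebra_simps power2_eq_square power3_eq_cube)
    thus ?thesis by simp
  qed
  hence "p dvd y" using na nb p(1) by (auto simp: prime_dvd_mult_iff prime_dvd_power_iff)
  with pu px show ?thesis by blast
qed

lemma cubic_norm_dvd_prime:
  fixes u x y p :: int
  assumes "squarefree a" "squarefree b" "coprime a b"
    and "Factorial_Ring.prime p" "p dvd int (a * b)" "p ^ 3 dvd cubic_norm a b u x y"
  shows "p dvd u \<and> p dvd x \<and> p dvd y"
proof -
  from assms(4,5) have "p dvd int a \<or> p dvd int b" by (simp add: prime_dvd_mult_iff)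
  thus ?thesis
    using cubic_norm_dvd_prime_left[of a b p u x y] cubic_norm_dvd_prime_left[of b a p u y x] assms
    by (auto simp: cubic_norm_swap[of a b] coprime_commute)
qed

lemma cubic_norm_dvd:
  fixes u x y d :: int
  assumes sf: "squarefree a" "squarefree b" "coprime a b"
    and d: "d \<noteq> 0" "\<And>p. Factorial_Ring.prime p \<Longrightarrow> p dvd d \<Longrightarrow> p dvd int (a * b)"
    and N: "d ^ 3 dvd cubic_norm a b u x y"
  shows "d dvd u \<and> d dvd x \<and> d dvd y"
  using d N
proof (induction d arbitrary: u x y rule: prime_divisors_induct)
  case (factor p d)
  have p0: "p \<noteq> 0" using factor.hyps by auto
  have "p ^ 3 dvd cubic_norm a b u x y"
    using factor.prems(3) by (metis dvd_trans dvd_triv_left power_mult_distrib)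
  with cubic_norm_dvd_prime[OF sf factor.hyps factor.prems(2)] factor.hyps
  have "p dvd u \<and> p dvd x \<and> p dvd y" by auto
  then obtain u' x' y' where e: "u = p * u'" "x = p * x'" "y = p * y'" unfolding dvd_def by blast
  have "d ^ 3 dvd cubic_norm a b u' x' y'"
    using factor.prems(3) p0 unfolding e cubic_norm_scale by (simp add: power_mult_distrib)
  hence "d dvd u' \<and> d dvd x' \<and> d dvd y'"
    using factor.IH[of u' x' y'] factor.prems by auto
  thus ?case unfolding e by auto
next
  case (unit d)
  thus ?case by (meson unit_imp_dvd)
qed auto

text \<open>
  Infinite descent at one prime divisor of \<open>a b\<close>. This plays the role of the irreducibility of \<open>X\<^sup>3 - a b\<^sup>2\<close>: it makes
  \<open>1, A, B\<close> linearly independent over the rationals.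
\<close>

lemma cubic_norm_int_eq_0:
  fixes u x y :: int
  assumes sf: "squarefree a" "squarefree b" "coprime a b" and ab: "a * b > 1"
    and N: "cubic_norm a b u x y = 0"
  shows "u = 0 \<and> x = 0 \<and> y = 0"
proof -
  obtain p where p: "Factorial_Ring.prime p" "p dvd a * b"
    using ab prime_factor_nat[of "a * b"] by (metis less_irrefl)
  have D: "int p ^ n dvd u \<and> int p ^ n dvd x \<and> int p ^ n dvd y" for n
  proof (rule cubic_norm_dvd[OF sf])
    fix q :: int assume q: "Factorial_Ring.prime q" "q dvd int p ^ n"
    hence "q dvd int p" using prime_dvd_power by blast
    thus "q dvd int (a * b)" using p(2) by (metis dvd_trans of_nat_dvd_iff)
  qed (use p N in \<open>auto simp: prime_gt_0_nat\<close>)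
  have Z: "z = 0" if "\<And>n. int p ^ n dvd z" for z :: int
  proof (rule ccontr)
    assume z: "z \<noteq> 0"
    have "int p ^ nat \<bar>z\<bar> \<le> \<bar>z\<bar>" using that z dvd_imp_le_int by (metis abs_of_nat of_nat_power)
    moreover have "nat \<bar>z\<bar> < p ^ nat \<bar>z\<bar>"
      using prime_ge_2_nat[OF p(1)] by (rule_tac power_gt_expt) auto
    ultimately show False by (simp flip: of_nat_power)
  qed
  show ?thesis using D Z by blast
qed

lemma rat_common_denominator3:
  fixes r s t :: rat
  shows "\<exists>D::int. D > 0 \<and> of_int D * r \<in> \<int> \<and> of_int D * s \<in> \<int> \<and> of_int D * t \<in> \<int>"
proof -
  have one: "\<exists>D::int. D > 0 \<and> of_int D * q \<in> \<int>" for q :: rat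
  proof -
    obtain n d where nd: "quotient_of q = (n, d)" by force
    hence "d > 0" "q = of_int n / of_int d"
      using quotient_of_denom_pos quotient_of_div by blast+
    thus ?thesis by (intro exI[of _ d]) auto
  qed
  obtain d e f where d: "d > 0" "of_int d * r \<in> \<int>" and e: "e > 0" "of_int e * s \<in> \<int>"
    and f: "f > 0" "of_int f * t \<in> \<int>"
    using one by metis
  have "of_int (d * e * f) * r = of_int (e * f) * (of_int d * r)"
       "of_int (d * e * f) * s = of_int (d * f) * (of_int e * s)"
       "of_int (d * e * f) * t = of_int (d * e) * (of_int f * t)" by (simp_all only: of_int_mult mult_ac)
  hence "of_int (d * e * f) * r \<in> \<int>" "of_int (d * e * f) * s \<in> \<int>" "of_int (d * e * f) * t \<in> \<int>"
    using d e f by (metis Ints_mult Ints_of_int)+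
  moreover have "d * e * f > 0" using d e f by simp
  ultimately show ?thesis by blast
qed

lemma cubic_norm_rat_eq_0:
  fixes r s t :: rat
  assumes sf: "squarefree a" "squarefree b" "coprime a b" and ab: "a * b > 1"
    and N: "cubic_norm a b r s t = 0"
  shows "r = 0 \<and> s = 0 \<and> t = 0"
proof -
  obtain D :: int where D: "D > 0" "of_int D * r \<in> \<int>" "of_int D * s \<in> \<int>" "of_int D * t \<in> \<int>"
    using rat_common_denominator3 by blast
  then obtain u x y where uxy: "of_int D * r = of_int u" "of_int D * s = of_int x" "of_int D * t = of_int y"
    by (auto elim!: Ints_cases)
  have "of_int (cubic_norm a b u x y) = (0 :: rat)"
    unfolding of_int_cubic_norm uxy[symmetric] cubic_norm_scale N by simp
  hence "cubic_norm a b u x y = 0" by simp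
  hence "u = 0 \<and> x = 0 \<and> y = 0"
    by (rule cubic_norm_int_eq_0[OF sf ab])
  thus ?thesis using uxy D(1) by auto
qed

section \<open>Coordinates in a pure cubic field\<close>

lemma complex_ring_simps:
  "\<one>\<^bsub>complex_ring\<^esub> = 1" "\<zero>\<^bsub>complex_ring\<^esub> = 0" "carrier complex_ring = UNIV"
  "x \<otimes>\<^bsub>complex_ring\<^esub> y = x * y" "x \<oplus>\<^bsub>complex_ring\<^esub> y = x + y"
  by (simp_all add: ring_of_type_algebra_def)

lemma complex_ring_a_inv: "\<ominus>\<^bsub>complex_ring\<^esub> x = - x"
proof -
  interpret R: ring complex_ring by (rule ring_from_type_algebra)
  show ?thesis by (rule R.minus_equality) (simp_all add: complex_ring_simps)
qed

lemma complex_ring_m_inv: "x \<noteq> 0 \<Longrightarrow> inv\<^bsub>complex_ring\<^esub> x = inverse x"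
proof -
  assume x: "x \<noteq> 0"
  interpret R: cring complex_ring by (rule cring_from_type_algebra)
  show ?thesis by (rule R.comm_inv_char) (simp_all add: complex_ring_simps x)
qed

lemmas complex_ring_ops = complex_ring_simps complex_ring_a_inv complex_ring_m_inv

lemma rat_adjoin_induct [consumes 1, case_names one base minus inverse add mult]:
  assumes "x \<in> rat_adjoin z" "P 1" "P z" "\<And>x. P x \<Longrightarrow> P (- x)"
    "\<And>x. P x \<Longrightarrow> x \<noteq> 0 \<Longrightarrow> P (inverse x)"
    "\<And>x y. P x \<Longrightarrow> P y \<Longrightarrow> P (x + y)" "\<And>x y. P x \<Longrightarrow> P y \<Longrightarrow> P (x * y)"
  shows "P x"
  using assms(1) unfolding rat_adjoin_def
  by (induction rule: generate_field.induct)
     (use assms(2-) in \<open>auto simp: complex_ring_ops\<close>)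

lemma rat_adjoin_closed:
  shows "1 \<in> rat_adjoin z" "z \<in> rat_adjoin z" "x \<in> rat_adjoin z \<Longrightarrow> - x \<in> rat_adjoin z"
    "x \<in> rat_adjoin z \<Longrightarrow> x \<noteq> 0 \<Longrightarrow> inverse x \<in> rat_adjoin z"
    "x \<in> rat_adjoin z \<Longrightarrow> y \<in> rat_adjoin z \<Longrightarrow> x + y \<in> rat_adjoin z"
    "x \<in> rat_adjoin z \<Longrightarrow> y \<in> rat_adjoin z \<Longrightarrow> x * y \<in> rat_adjoin z"
  unfolding rat_adjoin_def
  using generate_field.intros[where R = complex_ring and H = "{z}"]
  by (auto simp: complex_ring_simps simp flip: complex_ring_a_inv complex_ring_m_inv)

lemma rat_adjoin_of_nat: "of_nat n \<in> rat_adjoin z"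
proof (induction n)
  case 0
  have "1 + - 1 \<in> rat_adjoin z" by (intro rat_adjoin_closed)
  thus ?case by simp
qed (auto intro: rat_adjoin_closed)

lemma int_adjoin_induct [consumes 1, case_names one base minus add mult]:
  assumes "x \<in> int_adjoin z" "P 1" "P z" "\<And>x. P x \<Longrightarrow> P (- x)"
    "\<And>x y. P x \<Longrightarrow> P y \<Longrightarrow> P (x + y)" "\<And>x y. P x \<Longrightarrow> P y \<Longrightarrow> P (x * y)"
  shows "P x"
  using assms(1) unfolding int_adjoin_def
  by (induction rule: generate_ring.induct)
     (use assms(2-) in \<open>auto simp: complex_ring_ops\<close>)

lemma int_adjoin_closed:
  shows "1 \<in> int_adjoin z" "z \<in> int_adjoin z" "x \<in> int_adjoin z \<Longrightarrow> - x \<in> int_adjoin z"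
    "x \<in> int_adjoin z \<Longrightarrow> y \<in> int_adjoin z \<Longrightarrow> x + y \<in> int_adjoin z"
    "x \<in> int_adjoin z \<Longrightarrow> y \<in> int_adjoin z \<Longrightarrow> x * y \<in> int_adjoin z"
  unfolding int_adjoin_def
  using generate_ring.intros[where R = complex_ring and H = "{z}"]
  by (auto simp: complex_ring_simps simp flip: complex_ring_a_inv)

text \<open>
  \<open>A\<close> and \<open>B\<close> enter only through their multiplication table. Squarefree coprime \<open>a\<close> and \<open>b\<close> make
  \<open>a b\<^sup>2\<close> cube-free, and \<open>a b > 1\<close> excludes the rational field.
\<close>

locale cubic_pair =
  fixes a b :: nat and A B :: complex
  assumes squarefree_a: "squarefree a" and squarefree_b: "squarefree b"
    and coprime_ab: "coprime a b" and ab_gt_1: "a * b > 1"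
    and A_square: "A\<^sup>2 = of_nat b * B" and A_times_B: "A * B = of_nat (a * b)"
    and B_square: "B\<^sup>2 = of_nat a * A"
begin

definition elt :: "rat \<Rightarrow> rat \<Rightarrow> rat \<Rightarrow> complex" where
  "elt r s t = of_rat r + of_rat s * A + of_rat t * B"

lemma elt_add: "elt r s t + elt r' s' t' = elt (r + r') (s + s') (t + t')"
  by (simp add: elt_def of_rat_add algebra_simps)

lemma elt_minus: "- elt r s t = elt (- r) (- s) (- t)"
  by (simp add: elt_def of_rat_minus)

lemma elt_mult:
  "elt r s t * elt r' s' t' =
     elt (r * r' + of_nat (a * b) * (s * t' + t * s')) (r * s' + s * r' + of_nat a * (t * t'))
         (r * t' + t * r' + of_nat b * (s * s'))"
proof -
  have "elt r s t * elt r' s' t' = of_rat (r * r') + of_rat (r * s' + s * r') * A + of_rat (r * t' + t * r') * B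
     + of_rat (s * s') * A\<^sup>2 + of_rat (s * t' + t * s') * (A * B) + of_rat (t * t') * B\<^sup>2"
    by (simp add: elt_def of_rat_add of_rat_mult algebra_simps power2_eq_square)
  also have "\<dots> = elt (r * r' + of_nat (a * b) * (s * t' + t * s')) (r * s' + s * r' + of_nat a * (t * t'))
         (r * t' + t * r' + of_nat b * (s * s'))"
    unfolding A_square A_times_B B_square
    by (simp add: elt_def of_rat_add of_rat_mult algebra_simps)
  finally show ?thesis .
qed

lemma elt_of_rat: "elt r 0 0 = of_rat r"
  by (simp add: elt_def)

text \<open>
  The second factor is the product of the two other conjugates, written out in coordinates; up to the norm
  it is the inverse of the first.
\<close>

lemma elt_norm_identity:
  "elt r s t * elt (r\<^sup>2 - of_nat (a * b) * (s * t)) (of_nat a * t\<^sup>2 - r * s) (of_nat b * s\<^sup>2 - r * t)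
     = of_rat (cubic_norm a b r s t)"
  unfolding elt_mult elt_of_rat[symmetric] cubic_norm_def
  by (intro arg_cong3[where f = elt])
     (simp_all add: algebra_simps power2_eq_square power3_eq_cube)

lemma elt_eq_0_iff: "elt r s t = 0 \<longleftrightarrow> r = 0 \<and> s = 0 \<and> t = 0"
proof
  assume "elt r s t = 0"
  hence "cubic_norm a b r s t = 0" using elt_norm_identity[of r s t] by simp
  thus "r = 0 \<and> s = 0 \<and> t = 0"
    by (rule cubic_norm_rat_eq_0[OF squarefree_a squarefree_b coprime_ab ab_gt_1])
qed (simp add: elt_def)

lemma elt_eq_iff: "elt r s t = elt r' s' t' \<longleftrightarrow> r = r' \<and> s = s' \<and> t = t'"
proof -
  have "elt r s t = elt r' s' t' \<longleftrightarrow> elt r s t + - elt r' s' t' = 0" by simp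
  also have "\<dots> \<longleftrightarrow> r = r' \<and> s = s' \<and> t = t'"
    unfolding elt_minus elt_add elt_eq_0_iff by auto
  finally show ?thesis .
qed

lemma rat_adjoin_elt:
  assumes "x \<in> rat_adjoin A"
  obtains r s t where "x = elt r s t"
proof -
  from assms have "\<exists>r s t. x = elt r s t"
  proof (induction rule: rat_adjoin_induct)
    case one
    have "1 = elt 1 0 0" by (simp add: elt_def)
    thus ?case by blast
  next
    case base
    have "A = elt 0 1 0" by (simp add: elt_def)
    thus ?case by blast
  next
    case (inverse x)
    then obtain r s t where x: "x = elt r s t" by blast
    define N where "N = cubic_norm a b r s t"
    have "N \<noteq> 0"
      using cubic_norm_rat_eq_0[OF squarefree_a squarefree_b coprime_ab ab_gt_1, of r s t]
        inverse.hyps(1) x elt_eq_0_iff unfolding N_def by blast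
    let ?y = "elt (r\<^sup>2 - of_nat (a * b) * (s * t)) (of_nat a * t\<^sup>2 - r * s) (of_nat b * s\<^sup>2 - r * t)"
    have "x * (?y * elt (1 / N) 0 0) = (x * ?y) * elt (1 / N) 0 0"
      by (simp only: mult.assoc)
    also have "\<dots> = of_rat N * of_rat (1 / N)"
      unfolding x elt_norm_identity N_def elt_of_rat ..
    also have "\<dots> = 1" using \<open>N \<noteq> 0\<close> by (simp flip: of_rat_mult)
    finally have "x * (?y * elt (1 / N) 0 0) = 1" .
    hence "inverse x = ?y * elt (1 / N) 0 0"
      by (rule inverse_unique)
    thus ?case unfolding elt_mult by blast
  qed (metis elt_minus elt_add elt_mult)+
  thus ?thesis using that by blast
qed

lemma B_in_rat_adjoin: "B \<in> rat_adjoin A"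
proof -
  have b: "of_nat b \<noteq> (0 :: complex)" using ab_gt_1 by (cases "b = 0") auto
  hence "B = inverse (of_nat b) * (A * A)"
    using A_square by (simp add: power2_eq_square field_simps)
  moreover have "inverse (of_nat b) * (A * A) \<in> rat_adjoin A"
    by (intro rat_adjoin_closed rat_adjoin_of_nat b)
  ultimately show ?thesis by simp
qed

end

section \<open>Traces and norms of algebraic integers\<close>

text \<open>
  If a prime divided the denominator of \<open>q\<close>, the denominators of the powers of \<open>q\<close> would be unbounded.
\<close>

lemma rat_bounded_denominators_imp_Ints:
  fixes q :: rat and M :: int
  assumes M: "M \<noteq> 0" and pow: "\<And>j. of_int M * q ^ j \<in> \<int>"
  shows "q \<in> \<int>"
proof -
  obtain p d where pd: "quotient_of q = (p, d)" by force
  have d: "d > 0" and q: "q = of_int p / of_int d" and cop: "coprime p d"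
    using quotient_of_denom_pos[OF pd] quotient_of_div[OF pd] quotient_of_coprime[OF pd] by auto
  have dvd: "d ^ j dvd M" for j
  proof -
    obtain n where n: "of_int M * q ^ j = of_int n" using pow[of j] by (auto elim: Ints_cases)
    have "of_int (M * p ^ j) = (of_int (n * d ^ j) :: rat)"
      using n d by (simp add: q power_divide field_simps)
    hence "M * p ^ j = n * d ^ j" by (simp only: of_int_eq_iff)
    hence "d ^ j dvd M * p ^ j" by simp
    moreover have "coprime (d ^ j) (p ^ j)" using cop by (simp add: coprime_commute)
    ultimately show ?thesis using coprime_dvd_mult_left_iff by blast
  qed
  have "d = 1"
  proof (rule ccontr)
    assume "d \<noteq> 1"
    with d have d2: "d \<ge> 2" by simp
    have "int (nat \<bar>M\<bar>) < 2 ^ nat \<bar>M\<bar>" by (rule of_nat_less_two_power)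
    also have "\<dots> \<le> d ^ nat \<bar>M\<bar>" using d2 by (intro power_mono) auto
    also have "\<dots> \<le> \<bar>M\<bar>" using dvd[of "nat \<bar>M\<bar>"] M d by (metis abs_of_pos dvd_imp_le_int zero_less_power)
    finally show False by simp
  qed
  thus ?thesis by (simp add: q)
qed

lemma rat_half_integer_square:
  fixes x :: rat
  assumes "2 * x \<in> \<int>" "2 * x\<^sup>2 \<in> \<int>"
  shows "x \<in> \<int>"
proof -
  obtain p q where p: "2 * x = of_int p" and q: "2 * x\<^sup>2 = of_int q"
    using assms by (auto elim!: Ints_cases)
  have "(of_int (p\<^sup>2) :: rat) = of_int (2 * q)"
    by (simp flip: p q add: power2_eq_square)
  hence "p\<^sup>2 = 2 * q" by (simp only: of_int_eq_iff)
  hence "even (p\<^sup>2)" by simp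
  hence "even p" by simp
  then obtain n where "p = 2 * n" by auto
  hence "x = of_int n" using p by simp
  thus ?thesis by simp
qed

context cubic_pair
begin

text \<open>
  All powers of an algebraic integer \<open>\<theta>\<close> are integer combinations of finitely many of them, so one integer \<open>D\<close>
  clears the denominators of the coordinates of every power. Since the norm is multiplicative, the powers of the
  norm of \<open>\<theta>\<close> then have denominators dividing \<open>D\<^sup>3\<close>, which forces the norm to be an integer.
\<close>

lemma algebraic_int_norm_Ints:
  assumes x: "algebraic_int (elt r s t)"
  shows "cubic_norm a b r s t \<in> \<int>"
proof -
  define \<theta> where "\<theta> = elt r s t"
  define L where "L = {of_int u + of_int v * A + of_int w * B | u v w. True}"
  have L_elt: "L = {elt (of_int u) (of_int v) (of_int w) | u v w. True}"
    by (simp add: L_def elt_def)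
  have L_add: "y + z \<in> L" if yz: "y \<in> L" "z \<in> L" for y z
  proof -
    from yz obtain u v w u' v' w' where
      "y = of_int u + of_int v * A + of_int w * B" "z = of_int u' + of_int v' * A + of_int w' * B"
      unfolding L_def by blast
    hence "y + z = of_int (u + u') + of_int (v + v') * A + of_int (w + w') * B"
      by (simp add: algebra_simps)
    thus ?thesis unfolding L_def by blast
  qed
  have L_mult: "of_int c * y \<in> L" if y: "y \<in> L" for y c
  proof -
    from y obtain u v w where "y = of_int u + of_int v * A + of_int w * B"
      unfolding L_def by blast
    hence "of_int c * y = of_int (c * u) + of_int (c * v) * A + of_int (c * w) * B"
      by (simp add: algebra_simps)
    thus ?thesis unfolding L_def by blast
  qed
  have L_0: "0 \<in> L" unfolding L_def by (rule CollectI, intro exI[of _ 0]) simp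
  have L_sum: "(\<Sum>i\<in>I. f i) \<in> L" if "\<And>i. i \<in> I \<Longrightarrow> f i \<in> L" for f and I :: "nat set"
    using that by (induction I rule: infinite_finite_induct) (auto intro: L_add L_0)
  have power: "\<exists>r' s' t'. \<theta> ^ j = elt r' s' t' \<and> cubic_norm a b r' s' t' = cubic_norm a b r s t ^ j" for j
  proof (induction j)
    case 0
    have "elt 1 0 0 = 1" "cubic_norm a b 1 0 0 = (1 :: rat)" by (simp_all add: elt_def cubic_norm_def)
    thus ?case by (metis power_0)
  next
    case (Suc j)
    then obtain r' s' t' where "\<theta> ^ j = elt r' s' t'" "cubic_norm a b r' s' t' = cubic_norm a b r s t ^ j"
      by blast
    thus ?case
      by (metis \<theta>_def elt_mult cubic_norm_mult power_Suc)
  qed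
  have "\<exists>d::int. d > 0 \<and> of_int d * \<theta> ^ j \<in> L" for j
  proof -
    obtain r' s' t' where e: "\<theta> ^ j = elt r' s' t'" using power by blast
    obtain d :: int where d: "d > 0" "of_int d * r' \<in> \<int>" "of_int d * s' \<in> \<int>" "of_int d * t' \<in> \<int>"
      using rat_common_denominator3 by blast
    then obtain u v w where uvw: "of_int d * r' = of_int u" "of_int d * s' = of_int v" "of_int d * t' = of_int w"
      by (auto elim!: Ints_cases)
    have "of_int d * \<theta> ^ j = elt (of_int d * r') (of_int d * s') (of_int d * t')"
      by (simp add: e elt_def of_rat_mult algebra_simps)
    hence "of_int d * \<theta> ^ j \<in> L" unfolding uvw L_elt by blast
    thus ?thesis using d by blast
  qed
  then obtain d where d: "\<And>j. d j > (0 :: int)" "\<And>j. of_int (d j) * \<theta> ^ j \<in> L" by metis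
  obtain P :: "int poly" where P: "poly (map_poly of_int P) \<theta> = 0" "lead_coeff P = 1"
    using x unfolding \<theta>_def algebraic_int_altdef_ipoly by blast
  define n where "n = degree P"
  define D where "D = (\<Prod>i<n. d i)"
  have D0: "D > 0" unfolding D_def by (rule prod_pos) (use d in auto)
  have root: "\<theta> ^ n = (\<Sum>i<n. of_int (- coeff P i) * \<theta> ^ i)"
  proof -
    have "0 = (\<Sum>i\<le>n. of_int (coeff P i) * \<theta> ^ i)"
      using P(1) by (simp add: poly_altdef degree_map_poly coeff_map_poly n_def)
    also have "\<dots> = (\<Sum>i<n. of_int (coeff P i) * \<theta> ^ i) + \<theta> ^ n"
      using P(2) by (simp add: n_def flip: lessThan_Suc_atMost)
    finally show ?thesis by (simp add: sum_negf eq_neg_iff_add_eq_0 add.commute)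
  qed
  have DL: "of_int D * \<theta> ^ j \<in> L" for j
  proof (induction j rule: less_induct)
    case (less j)
    show ?case
    proof (cases "j < n")
      case True
      have "D = (\<Prod>i\<in>{..<n} - {j}. d i) * d j"
        unfolding D_def using True by (subst prod.remove[of _ j]) auto
      hence "of_int D * \<theta> ^ j = of_int (\<Prod>i\<in>{..<n} - {j}. d i) * (of_int (d j) * \<theta> ^ j)"
        by (simp add: mult.assoc)
      thus ?thesis using L_mult[OF d(2)] by metis
    next
      case False
      have "of_int D * \<theta> ^ j = of_int D * \<theta> ^ (j - n) * \<theta> ^ n"
        using False by (simp flip: power_add add: mult.assoc)
      also have "\<dots> = (\<Sum>i<n. of_int (- coeff P i) * (of_int D * \<theta> ^ (j - n + i)))"
        unfolding root by (simp add: sum_distrib_left power_add mult_ac)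
      also have "\<dots> \<in> L"
        by (intro L_sum L_mult less) (use False in auto)
      finally show ?thesis .
    qed
  qed
  show ?thesis
  proof (rule rat_bounded_denominators_imp_Ints)
    show "D ^ 3 \<noteq> 0" using D0 by simp
    fix j
    obtain r' s' t' where e: "\<theta> ^ j = elt r' s' t'" "cubic_norm a b r' s' t' = cubic_norm a b r s t ^ j"
      using power by blast
    obtain u v w where "of_int D * \<theta> ^ j = elt (of_int u) (of_int v) (of_int w)"
      using DL[of j] unfolding L_elt by blast
    moreover have "of_int D * \<theta> ^ j = elt (of_int D * r') (of_int D * s') (of_int D * t')"
      by (simp add: e elt_def of_rat_mult algebra_simps)
    ultimately have uvw: "of_int D * r' = of_int u" "of_int D * s' = of_int v" "of_int D * t' = of_int w"
      by (simp_all add: elt_eq_iff)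
    have "of_int (D ^ 3) * cubic_norm a b r s t ^ j = cubic_norm a b (of_int D * r') (of_int D * s') (of_int D * t')"
      by (simp add: cubic_norm_scale e)
    also have "\<dots> = of_int (cubic_norm a b u v w)"
      unfolding uvw of_int_cubic_norm ..
    finally show "of_int (D ^ 3) * cubic_norm a b r s t ^ j \<in> \<int>" by simp
  qed
qed

text \<open>
  Let \<open>T = 3 r\<close> be the trace of an element and \<open>Q\<close> the second symmetric function of its conjugates. The norms of the
  element and of its shifts by \<open>1\<close> and \<open>-1\<close> are integers, so \<open>2 T\<close> and \<open>T + Q\<close> are. The trace of
  the square is \<open>T\<^sup>2 - 2 Q\<close>; its double is an integer for the same reason, so \<open>2 T\<^sup>2\<close> is an integer as well, and \<open>T\<close>
  cannot be a proper half integer.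
\<close>

lemma integral_subring_trace_Ints:
  assumes R: "\<And>x. x \<in> R \<Longrightarrow> algebraic_int x" "1 \<in> R" "\<And>x. x \<in> R \<Longrightarrow> - x \<in> R"
    "\<And>x y. x \<in> R \<Longrightarrow> y \<in> R \<Longrightarrow> x + y \<in> R" "\<And>x y. x \<in> R \<Longrightarrow> y \<in> R \<Longrightarrow> x * y \<in> R"
  and x: "elt r s t \<in> R"
  shows "3 * r \<in> \<int>" and "3 * r\<^sup>2 - 3 * of_nat (a * b) * (s * t) \<in> \<int>"
proof -
  have norm_shift: "cubic_norm a b (r + c) s t = cubic_norm a b r s t + c ^ 3 + 3 * r * c\<^sup>2
      + (3 * r\<^sup>2 - 3 * of_nat (a * b) * (s * t)) * c" for r s t c :: rat
    by (simp add: cubic_norm_def algebra_simps power2_eq_square power3_eq_cube)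
  have "1 = elt 1 0 0" by (simp add: elt_def)
  hence 1: "elt 1 0 0 \<in> R" "elt (-1) 0 0 \<in> R" using R(2) R(3)[OF R(2)] elt_minus[of 1 0 0] by simp_all
  have *: "6 * r \<in> \<int> \<and> 3 * r + (3 * r\<^sup>2 - 3 * of_nat (a * b) * (s * t)) \<in> \<int>"
    if x: "elt r s t \<in> R" for r s t
  proof -
    define Q where "Q = 3 * r\<^sup>2 - 3 * of_nat (a * b) * (s * t)"
    have "elt (r + 1) s t \<in> R" "elt (r - 1) s t \<in> R"
      using R(4)[OF x 1(1)] R(4)[OF x 1(2)] by (simp_all add: elt_add)
    hence "cubic_norm a b r s t \<in> \<int>" "cubic_norm a b (r + 1) s t \<in> \<int>" "cubic_norm a b (r + - 1) s t \<in> \<int>"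
      using x R(1) algebraic_int_norm_Ints by auto
    then obtain i j k where ijk: "cubic_norm a b r s t = of_int i"
        "cubic_norm a b (r + 1) s t = of_int j" "cubic_norm a b (r + - 1) s t = of_int k"
      by (elim Ints_cases) blast
    have N: "of_int i + 1 + 3 * r + Q = of_int j" "of_int i - 1 + 3 * r - Q = of_int k"
      using ijk(2,3) unfolding norm_shift ijk(1) Q_def by simp_all
    have "6 * r = of_int (j + k - 2 * i)" "3 * r + Q = of_int (j - i - 1)"
      using N by simp_all
    thus ?thesis unfolding Q_def by (metis Ints_of_int)
  qed
  define Q where "Q = 3 * r\<^sup>2 - 3 * of_nat (a * b) * (s * t)"
  have "6 * (r * r + of_nat (a * b) * (s * t + t * s)) \<in> \<int>"
    using *[OF R(5)[OF x x, unfolded elt_mult]] by blast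
  then obtain i where i: "6 * (r * r + of_nat (a * b) * (s * t + t * s)) = of_int i" by (auto elim: Ints_cases)
  obtain j where j: "6 * r = of_int j" using *[OF x] by (auto elim: Ints_cases)
  obtain l where l: "3 * r + Q = of_int l" using *[OF x] unfolding Q_def by (auto elim: Ints_cases)
  have "2 * (3 * r)\<^sup>2 = 6 * (r * r + of_nat (a * b) * (s * t + t * s)) + 4 * (3 * r + Q) - 2 * (6 * r)"
    by (simp add: Q_def algebra_simps power2_eq_square)
  also have "\<dots> = of_int (i + 4 * l - 2 * j)"
    unfolding i j l by simp
  finally have "2 * (3 * r)\<^sup>2 \<in> \<int>" by (simp only: Ints_of_int)
  moreover have "2 * (3 * r) \<in> \<int>"
  proof -
    have "2 * (3 * r) = of_int j" using j by simp
    thus ?thesis by (simp only: Ints_of_int)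
  qed
  ultimately have r: "3 * r \<in> \<int>" by (rule rat_half_integer_square[rotated])
  show "3 * r \<in> \<int>" by fact
  have "Q = of_int l - 3 * r" using l by simp
  hence "Q \<in> \<int>" using r by (simp only: Ints_diff Ints_of_int)
  thus "3 * r\<^sup>2 - 3 * of_nat (a * b) * (s * t) \<in> \<int>" unfolding Q_def .
qed

end

section \<open>Monogenic pure cubic fields and the Thue equation\<close>

lemma algebraic_int_if_power_nat:
  fixes z :: complex
  assumes "z ^ n = of_nat m" "n > 0"
  shows "algebraic_int z"
proof (rule algebraic_int_root)
  show "poly (monom 1 n) z = of_nat m" using assms by (simp add: poly_monom)
qed (use assms in \<open>auto simp: degree_monom_eq int_imp_algebraic_int\<close>)

lemma rat_adjoin_of_rat: "of_rat q \<in> rat_adjoin z"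
proof -
  obtain p d where pd: "quotient_of q = (p, d)" by force
  have d: "d > 0" and q: "q = of_int p / of_int d"
    using quotient_of_denom_pos[OF pd] quotient_of_div[OF pd] by auto
  have int: "of_int n \<in> rat_adjoin z" for n
    by (cases n rule: int_cases2) (auto intro: rat_adjoin_of_nat rat_adjoin_closed)
  have "of_int p * inverse (of_int d) \<in> rat_adjoin z"
    using d by (intro rat_adjoin_closed int) auto
  moreover have "of_rat q = (of_int p * inverse (of_int d) :: complex)"
    by (simp only: q of_rat_divide of_rat_of_int_eq) (simp only: divide_inverse)
  ultimately show ?thesis by simp
qed

lemma int_dvd_27_not_3_dvd_unit:
  fixes c :: int
  assumes "c dvd 27" "\<not> 3 dvd c"
  shows "is_unit c"
proof -
  have "coprime 3 c" using assms(2) by (intro prime_imp_coprime) auto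
  hence "coprime (3 ^ 3) c" by (intro coprime_power_left_iff[THEN iffD2] disjI1)
  hence "coprime c 27" by (simp add: coprime_commute)
  thus ?thesis using assms(1) by (simp add: coprime_absorb_left)
qed

context cubic_pair
begin

lemma elt_in_rat_adjoin: "elt r s t \<in> rat_adjoin A"
  unfolding elt_def by (intro rat_adjoin_closed rat_adjoin_of_rat B_in_rat_adjoin)

lemma algebraic_int_A: "algebraic_int A"
proof (rule algebraic_int_if_power_nat)
  have "A ^ 3 = A\<^sup>2 * A" by (simp add: power3_eq_cube power2_eq_square)
  also have "\<dots> = of_nat b * (A * B)" unfolding A_square by simp
  also have "\<dots> = of_nat (b * (a * b))" unfolding A_times_B by simp
  finally show "A ^ 3 = of_nat (b * (a * b))" .
qed simp

lemma algebraic_int_B: "algebraic_int B"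
proof (rule algebraic_int_if_power_nat)
  have "B ^ 3 = B\<^sup>2 * B" by (simp add: power3_eq_cube power2_eq_square)
  also have "\<dots> = of_nat a * (A * B)" unfolding B_square by simp
  also have "\<dots> = of_nat (a * (a * b))" unfolding A_times_B by simp
  finally show "B ^ 3 = of_nat (a * (a * b))" .
qed simp

text \<open>
  The characteristic polynomial of an element, with coefficients trace, second symmetric function and norm.
\<close>

lemma elt_cubic_equation:
  "elt r s t ^ 3 = of_rat (3 * r) * elt r s t ^ 2
     - of_rat (3 * r\<^sup>2 - 3 * of_nat (a * b) * (s * t)) * elt r s t + of_rat (cubic_norm a b r s t)"
proof -
  have diff: "elt u v w - elt u' v' w' = elt (u - u') (v - v') (w - w')" for u v w u' v' w'
    using elt_add[of u v w "- u'" "- v'" "- w'"] elt_minus[of u' v' w']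
    by (simp only: diff_conv_add_uminus)
  show ?thesis
    unfolding power2_eq_square power3_eq_cube elt_of_rat[symmetric] elt_mult diff elt_add cubic_norm_def
    by (intro arg_cong3[where f = elt])
       (simp_all add: algebra_simps power2_eq_square power3_eq_cube)
qed

lemma algebraic_int_elt:
  assumes "3 * r \<in> \<int>" "3 * r\<^sup>2 - 3 * of_nat (a * b) * (s * t) \<in> \<int>" "cubic_norm a b r s t \<in> \<int>"
  shows "algebraic_int (elt r s t)"
proof -
  obtain T Q N where e: "3 * r = of_int T" "3 * r\<^sup>2 - 3 * of_nat (a * b) * (s * t) = of_int Q"
    "cubic_norm a b r s t = of_int N" using assms by (auto elim!: Ints_cases)
  define p :: "complex poly" where "p = [:- of_int N, of_int Q, - of_int T, 1:]"
  have "poly p (elt r s t) = elt r s t ^ 3 - of_int T * elt r s t ^ 2 + of_int Q * elt r s t - of_int N"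
    by (simp add: p_def algebra_simps power2_eq_square power3_eq_cube)
  also have "\<dots> = 0"
    unfolding elt_cubic_equation e by (simp add: of_rat_of_int_eq)
  finally show ?thesis
    by (intro algebraic_int.intros[of p]) (auto simp: p_def coeff_pCons split: nat.splits)
qed

text \<open>
  For integral \<open>\<theta>\<close> the cubic equation shows that \<open>\<int>[\<theta>]\<close> is spanned by \<open>1, \<theta>, \<theta>\<^sup>2\<close>. The two equations are
  the coordinates of \<open>p \<theta> + q \<theta>\<^sup>2\<close> at \<open>A\<close> and \<open>B\<close>.
\<close>

lemma int_adjoin_coordinates:
  assumes \<theta>: "3 * r \<in> \<int>" "3 * r\<^sup>2 - 3 * of_nat (a * b) * (s * t) \<in> \<int>" "cubic_norm a b r s t \<in> \<int>"
    and z: "elt u v w \<in> int_adjoin (elt r s t)"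
  obtains p q :: int where "v = of_int p * s + of_int q * (2 * r * s + of_nat a * t\<^sup>2)"
    "w = of_int p * t + of_int q * (2 * r * t + of_nat b * s\<^sup>2)"
proof -
  obtain T Q N where e: "3 * r = of_int T" "3 * r\<^sup>2 - 3 * of_nat (a * b) * (s * t) = of_int Q"
    "cubic_norm a b r s t = of_int N" using \<theta> by (auto elim!: Ints_cases)
  define \<theta> where "\<theta> = elt r s t"
  have cube: "\<theta> ^ 3 = of_int T * \<theta>\<^sup>2 - of_int Q * \<theta> + of_int N"
    using elt_cubic_equation[of r s t] unfolding e \<theta>_def by (simp add: of_rat_of_int_eq)
  define L where "L = {of_int i + of_int j * \<theta> + of_int k * \<theta>\<^sup>2 | i j k. True}"
  have L_I: "of_int i + of_int j * \<theta> + of_int k * \<theta>\<^sup>2 \<in> L" for i j k unfolding L_def by blast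
  have L_add: "y + z \<in> L" if yz: "y \<in> L" "z \<in> L" for y z
  proof -
    from yz obtain i j k i' j' k' where
      "y = of_int i + of_int j * \<theta> + of_int k * \<theta>\<^sup>2" "z = of_int i' + of_int j' * \<theta> + of_int k' * \<theta>\<^sup>2"
      unfolding L_def by blast
    hence "y + z = of_int (i + i') + of_int (j + j') * \<theta> + of_int (k + k') * \<theta>\<^sup>2"
      by (simp add: algebra_simps)
    thus ?thesis using L_I by metis
  qed
  have L_scale: "of_int c * y \<in> L" if y: "y \<in> L" for y c
  proof -
    from y obtain i j k where "y = of_int i + of_int j * \<theta> + of_int k * \<theta>\<^sup>2" unfolding L_def by blast
    hence "of_int c * y = of_int (c * i) + of_int (c * j) * \<theta> + of_int (c * k) * \<theta>\<^sup>2"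
      by (simp add: algebra_simps)
    thus ?thesis using L_I by metis
  qed
  have L_theta: "\<theta> * y \<in> L" if y: "y \<in> L" for y
  proof -
    from y obtain i j k where "y = of_int i + of_int j * \<theta> + of_int k * \<theta>\<^sup>2" unfolding L_def by blast
    hence "\<theta> * y = of_int i * \<theta> + of_int j * \<theta>\<^sup>2 + of_int k * \<theta> ^ 3"
      by (simp add: algebra_simps power2_eq_square power3_eq_cube)
    also have "\<dots> = of_int (k * N) + of_int (i - k * Q) * \<theta> + of_int (j + k * T) * \<theta>\<^sup>2"
      unfolding cube by (simp add: algebra_simps)
    finally show ?thesis using L_I by metis
  qed
  have L_mult: "y * z \<in> L" if yz: "y \<in> L" "z \<in> L" for y z
  proof -
    from yz obtain i j k where "y = of_int i + of_int j * \<theta> + of_int k * \<theta>\<^sup>2" unfolding L_def by blast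
    hence "y * z = of_int i * z + of_int j * (\<theta> * z) + of_int k * (\<theta> * (\<theta> * z))"
      by (simp add: algebra_simps power2_eq_square)
    thus ?thesis using yz by (auto intro!: L_add L_scale L_theta)
  qed
  have "elt u v w \<in> L"
    using z unfolding \<theta>_def[symmetric]
  proof (induction rule: int_adjoin_induct)
    case one thus ?case using L_I[of 1 0 0] by simp
  next
    case base thus ?case using L_I[of 0 1 0] by simp
  next
    case (minus x) thus ?case using L_scale[of x "-1"] by simp
  qed (auto intro: L_add L_mult)
  then obtain i j k where ijk: "elt u v w = of_int i + of_int j * \<theta> + of_int k * \<theta>\<^sup>2"
    unfolding L_def by blast
  also have "\<dots> = of_rat (of_int i) + of_rat (of_int j) * \<theta> + of_rat (of_int k) * (\<theta> * \<theta>)"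
    by (simp add: of_rat_of_int_eq power2_eq_square)
  finally have "v = of_int j * s + of_int k * (2 * r * s + of_nat a * t\<^sup>2)"
    "w = of_int j * t + of_int k * (2 * r * t + of_nat b * s\<^sup>2)"
    unfolding \<theta>_def elt_of_rat[symmetric] elt_mult elt_add elt_eq_iff
    by (simp_all add: algebra_simps power2_eq_square)
  thus ?thesis by (rule that)
qed

context
  fixes r s t :: rat
  assumes generator: "ring_of_integers (rat_adjoin A) = int_adjoin (elt r s t)"
begin

text \<open>
  The ring of integers is closed under addition and multiplication because it equals \<open>\<int>[\<theta>]\<close>, which makes the
  results on integral subrings applicable to it.
\<close>

lemma integers_of_elt:
  assumes "elt u v w \<in> int_adjoin (elt r s t)"
  shows "3 * u \<in> \<int>" "3 * u\<^sup>2 - 3 * of_nat (a * b) * (v * w) \<in> \<int>" "cubic_norm a b u v w \<in> \<int>"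
proof -
  have alg: "algebraic_int x" if "x \<in> int_adjoin (elt r s t)" for x
    using that unfolding generator[symmetric] by (simp add: ring_of_integers_def)
  show "cubic_norm a b u v w \<in> \<int>" by (rule algebraic_int_norm_Ints[OF alg[OF assms]])
  show "3 * u \<in> \<int>" "3 * u\<^sup>2 - 3 * of_nat (a * b) * (v * w) \<in> \<int>"
    using integral_subring_trace_Ints[OF alg int_adjoin_closed(1,3,4,5) assms] by auto
qed

lemmas generator_integers = integers_of_elt[OF int_adjoin_closed(2)]

lemma A_in_int_adjoin: "A \<in> int_adjoin (elt r s t)"
  unfolding generator[symmetric] by (simp add: ring_of_integers_def algebraic_int_A rat_adjoin_closed)

lemma B_in_int_adjoin: "B \<in> int_adjoin (elt r s t)"
  unfolding generator[symmetric] by (simp add: ring_of_integers_def algebraic_int_B B_in_rat_adjoin)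

text \<open>
  The integer matrix expressing \<open>A, B\<close> by \<open>\<theta>, \<theta>\<^sup>2\<close> modulo constants is inverse to the rational matrix
  expressing \<open>\<theta>, \<theta>\<^sup>2\<close> by \<open>A, B\<close>. The determinant of the latter is \<open>b s\<^sup>3 - a t\<^sup>3\<close>.
\<close>

lemma generator_index_equation:
  obtains I :: int where "of_int I * (of_nat b * s ^ 3 - of_nat a * t ^ 3) = 1"
proof -
  have "elt 0 1 0 \<in> int_adjoin (elt r s t)" "elt 0 0 1 \<in> int_adjoin (elt r s t)"
    using A_in_int_adjoin B_in_int_adjoin by (simp_all add: elt_def)
  then obtain p q p' q' :: int where
    "1 = of_int p * s + of_int q * (2 * r * s + of_nat a * t\<^sup>2)"
    "0 = of_int p * t + of_int q * (2 * r * t + of_nat b * s\<^sup>2)"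
    "0 = of_int p' * s + of_int q' * (2 * r * s + of_nat a * t\<^sup>2)"
    "1 = of_int p' * t + of_int q' * (2 * r * t + of_nat b * s\<^sup>2)"
    using int_adjoin_coordinates[OF generator_integers] by metis
  note pq = this
  have "of_int (p * q' - p' * q) * (of_nat b * s ^ 3 - of_nat a * t ^ 3)
      = (of_int p * s + of_int q * (2 * r * s + of_nat a * t\<^sup>2)) * (of_int p' * t + of_int q' * (2 * r * t + of_nat b * s\<^sup>2))
      - (of_int p * t + of_int q * (2 * r * t + of_nat b * s\<^sup>2)) * (of_int p' * s + of_int q' * (2 * r * s + of_nat a * t\<^sup>2))"
    by (simp add: algebra_simps power2_eq_square power3_eq_cube)
  also have "\<dots> = 1" unfolding pq[symmetric] by simp
  finally show ?thesis by (rule that)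
qed

text \<open>
  The traces of \<open>\<theta>\<close>, \<open>\<theta> A\<close> and \<open>\<theta> B\<close> show that \<open>3 a b\<close> is a common denominator of the coordinates of \<open>\<theta>\<close>. The norm is
  an integer, so every prime factor of \<open>a b\<close> can be removed from this denominator by \<open>cubic_norm_dvd\<close>. If
  \<open>3\<close> divides \<open>a b\<close>, the remaining factor \<open>3\<close> goes as well; that is what \<open>d\<close> accounts for.
\<close>

lemma generator_denominators:
  obtains e x y :: int where "e = 1 \<or> e = 3 \<and> \<not> 3 dvd a * b" "of_int e * s = of_int x" "of_int e * t = of_int y"
proof -
  have "elt 0 1 0 \<in> int_adjoin (elt r s t)" "elt 0 0 1 \<in> int_adjoin (elt r s t)"
    using A_in_int_adjoin B_in_int_adjoin by (simp_all add: elt_def)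
  hence "elt r s t * elt 0 1 0 \<in> int_adjoin (elt r s t)" "elt r s t * elt 0 0 1 \<in> int_adjoin (elt r s t)"
    by (auto intro: int_adjoin_closed)
  hence "3 * (of_nat (a * b) * t) \<in> \<int>" "3 * (of_nat (a * b) * s) \<in> \<int>"
    unfolding elt_mult using integers_of_elt(1) by fastforce+
  moreover have "3 * r \<in> \<int>" "cubic_norm a b r s t \<in> \<int>" using generator_integers by auto
  ultimately obtain x y u N where i: "3 * (of_nat (a * b) * s) = of_int x" "3 * (of_nat (a * b) * t) = of_int y"
    "3 * r = of_int u" "cubic_norm a b r s t = of_int N"
    by (auto elim!: Ints_cases)
  define d :: int where "d = (if 3 dvd a * b then 3 else 1)"
  define e :: int where "e = (if 3 dvd a * b then 1 else 3)"
  have de: "d * e = 3" by (simp add: d_def e_def)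
  define n where "n = int (a * b)"
  have "a * b \<noteq> 0" using ab_gt_1 by linarith
  hence n0: "n \<noteq> 0" unfolding n_def by (metis of_nat_eq_0_iff)
  have i': "of_int (d * n) * (of_int e * s) = of_int x" "of_int (d * n) * (of_int e * t) = of_int y"
    "of_int (d * n) * (of_int e * r) = of_int (n * u)"
  proof -
    have de': "of_int d * of_int e = (3 :: rat)" using de by (metis of_int_mult of_int_numeral)
    have *: "of_int (d * n) * (of_int e * z) = 3 * (of_int n * z)" for z :: rat
    proof -
      have "of_int (d * n) * (of_int e * z) = (of_int d * of_int e) * (of_int n * z)" by simp
      thus ?thesis unfolding de' .
    qed
    show "of_int (d * n) * (of_int e * s) = of_int x" "of_int (d * n) * (of_int e * t) = of_int y"
      unfolding * i[symmetric] by (simp_all add: n_def)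
    have "3 * (of_int n * r) = of_int n * (3 * r)" by simp
    thus "of_int (d * n) * (of_int e * r) = of_int (n * u)"
      unfolding * i by simp
  qed
  have "(of_int (cubic_norm a b (n * u) x y) :: rat) = of_int ((d * n) ^ 3 * (e ^ 3 * N))"
    unfolding of_int_cubic_norm i'[symmetric] cubic_norm_scale i by simp
  hence "cubic_norm a b (n * u) x y = (d * n) ^ 3 * (e ^ 3 * N)" by (simp only: of_int_eq_iff)
  hence "(d * n) ^ 3 dvd cubic_norm a b (n * u) x y" by simp
  hence "d * n dvd n * u \<and> d * n dvd x \<and> d * n dvd y"
  proof (rule cubic_norm_dvd[OF squarefree_a squarefree_b coprime_ab, rotated 2])
    show "d * n \<noteq> 0" using n0 by (simp add: d_def)
    fix p :: int assume p: "Factorial_Ring.prime p" "p dvd d * n"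
    hence "p dvd d \<or> p dvd n" by (simp add: prime_dvd_mult_iff)
    moreover have "d dvd n"
    proof (cases "3 dvd a * b")
      case True
      hence "int 3 dvd int (a * b)" by (metis of_nat_dvd_iff)
      thus ?thesis using True by (simp add: d_def n_def)
    qed (simp add: d_def)
    ultimately show "p dvd int (a * b)" unfolding n_def by (meson dvd_trans)
  qed
  then obtain x' y' where xy: "x = d * n * x'" "y = d * n * y'" by (auto elim!: dvdE)
  have dn: "of_int (d * n) \<noteq> (0 :: rat)" using n0 by (simp add: d_def)
  show ?thesis
  proof (rule that)
    show "e = 1 \<or> e = 3 \<and> \<not> 3 dvd a * b" by (simp add: e_def)
    show "of_int e * s = of_int x'" "of_int e * t = of_int y'"
      using i'(1,2) dn unfolding xy by simp_all
  qed
qed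

end

text \<open>
  Clearing the denominator \<open>e\<close> turns \<open>I (b s\<^sup>3 - a t\<^sup>3) = 1\<close> into \<open>I c = e\<^sup>3\<close>. A common prime factor of \<open>c\<close> and \<open>a y\<close> can only
  be \<open>3\<close>; as \<open>e = 3\<close> excludes \<open>3 dvd a\<close>, it divides \<open>y\<close> and then \<open>x\<close>; in that case \<open>s\<close> and \<open>t\<close> are integers, and they give a solution with \<open>c\<close> a unit.
\<close>

lemma generator_thue_equation:
  assumes gen: "ring_of_integers (rat_adjoin A) = int_adjoin (elt r s t)"
  obtains x y c :: int where "int b * x ^ 3 - int a * y ^ 3 = c" "c dvd 27" "coprime c (int a * y)"
    "y = 0 \<longleftrightarrow> t = 0"
proof -
  obtain I :: int where I: "of_int I * (of_nat b * s ^ 3 - of_nat a * t ^ 3) = 1"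
    by (rule generator_index_equation[OF gen])
  obtain e x y :: int where e: "e = 1 \<or> e = 3 \<and> \<not> 3 dvd a * b"
    and xy: "of_int e * s = of_int x" "of_int e * t = of_int y"
    by (rule generator_denominators[OF gen])
  define c where "c = int b * x ^ 3 - int a * y ^ 3"
  have "of_int (I * c) = of_int I * (of_nat b * (of_int e * s) ^ 3 - of_nat a * (of_int e * t) ^ 3)"
    unfolding xy by (simp add: c_def)
  also have "\<dots> = of_int e ^ 3 * (of_int I * (of_nat b * s ^ 3 - of_nat a * t ^ 3))"
    by (simp add: algebra_simps power_mult_distrib)
  also have "\<dots> = of_int (e ^ 3)" unfolding I by simp
  finally have Ic: "I * c = e ^ 3" by (simp only: of_int_eq_iff)
  have y0: "y = 0 \<longleftrightarrow> t = 0" using e xy by auto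
  show ?thesis
  proof (cases "is_unit c")
    case True
    thus ?thesis using that[OF c_def[symmetric] unit_imp_dvd[OF True] is_unit_left_imp_coprime[OF True] y0] by blast
  next
    case False
    have "e \<noteq> 1" using False Ic by (metis dvd_triv_right power_one)
    hence e3: "e = 3" "\<not> 3 dvd a * b" using e by auto
    have "I * c = 27" using Ic e3 by simp
    hence c27: "c dvd 27" by (metis dvd_triv_right)
    have c3: "3 dvd c" using int_dvd_27_not_3_dvd_unit[OF c27] False by blast
    have "\<not> int 3 dvd int (a * b)" using e3(2) by (metis of_nat_dvd_iff)
    hence n3: "\<not> 3 dvd int a" "\<not> 3 dvd int b" by auto
    show ?thesis
    proof (cases "3 dvd y")
      case False
      have "\<not> 3 dvd int a * y" using False n3 by (simp add: prime_dvd_mult_iff)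
      hence "coprime 3 (int a * y)" by (intro prime_imp_coprime) auto
      hence "coprime (3 ^ 3) (int a * y)" by (intro coprime_power_left_iff[THEN iffD2] disjI1)
      hence "coprime c (int a * y)" using coprime_divisors[of c 27 "int a * y" "int a * y"] c27 by simp
      thus ?thesis using that[of x y c] c27 y0 by (simp add: c_def)
    next
      case True
      have "int b * x ^ 3 = c + int a * y ^ 3" by (simp add: c_def)
      hence "3 dvd int b * x ^ 3" using True c3 by (simp add: prime_dvd_power_iff)
      hence "3 dvd x" using n3 by (simp add: prime_dvd_mult_iff prime_dvd_power_iff)
      then obtain x' y' where x': "x = 3 * x'" and y': "y = 3 * y'" using True by (auto elim!: dvdE)
      have "27 * (I * (int b * x' ^ 3 - int a * y' ^ 3)) = 27"
        using Ic e3 unfolding c_def x' y' by (simp add: algebra_simps power_mult_distrib)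
      hence "I * (int b * x' ^ 3 - int a * y' ^ 3) = 1" by simp
      hence unit: "is_unit (int b * x' ^ 3 - int a * y' ^ 3)" by (metis dvd_triv_right)
      have "y' = 0 \<longleftrightarrow> t = 0" using y0 y' by simp
      thus ?thesis
        using that[OF refl unit_imp_dvd[OF unit] is_unit_left_imp_coprime[OF unit]] by blast
    qed
  qed
qed

text \<open>
  For \<open>a = \<epsilon> (mod 9)\<close> the number \<open>(1 + \<epsilon> A + A\<^sup>2) / 3\<close> is an algebraic integer. If \<open>\<theta> = r + s A\<close>, then it can only lie in
  \<open>\<int>[\<theta>]\<close> if \<open>3 q s\<^sup>2 = 1\<close> for an integer \<open>q\<close>, so \<open>s = 1/3\<close> or \<open>s = -1/3\<close>. But then \<open>r\<close> is an integer, and the norm of \<open>\<theta>\<close>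
  is not, because \<open>27\<close> does not divide the squarefree number \<open>a\<close>.
\<close>

lemma generator_B_coordinate_nonzero:
  assumes gen: "ring_of_integers (rat_adjoin A) = int_adjoin (elt r s t)"
    and b: "b = 1" and a: "[int a = \<epsilon>] (mod 9)" "\<epsilon> = 1 \<or> \<epsilon> = -1"
  shows "t \<noteq> 0"
proof
  assume t: "t = 0"
  obtain I :: int where "of_int I * (of_nat b * s ^ 3 - of_nat a * t ^ 3) = 1"
    by (rule generator_index_equation[OF gen])
  hence I: "of_int I * s ^ 3 = 1" by (simp add: b t)
  obtain e x y :: int where e: "e = 1 \<or> e = 3 \<and> \<not> 3 dvd a * b"
    and xy: "of_int e * s = of_int x" "of_int e * t = of_int y"
    by (rule generator_denominators[OF gen])
  obtain j where j: "int a = \<epsilon> + 9 * j"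
    using a(1) by (metis cong_iff_lin cong_sym mult.commute)
  have aj: "of_nat a = (of_int (\<epsilon> + 9 * j) :: rat)" by (metis j of_int_of_nat_eq)
  have e2: "\<epsilon> * \<epsilon> = 1" using a(2) by auto
  have e2': "of_int \<epsilon> * of_int \<epsilon> = (1 :: rat)" using e2 by (metis of_int_1 of_int_mult)
  \<comment> \<open>As \<open>b = 1\<close>, \<open>B = A\<^sup>2\<close>.\<close>
  have "algebraic_int (elt (1/3) (of_int \<epsilon> / 3) (1/3))"
  proof (rule algebraic_int_elt)
    have "3 * (1/3)\<^sup>2 - 3 * of_nat (a * b) * (of_int \<epsilon> / 3 * (1/3)) = (of_int (- 3 * \<epsilon> * j) :: rat)"
      using e2' by (simp add: aj b field_simps power2_eq_square)
    thus "3 * (1/3)\<^sup>2 - 3 * of_nat (a * b) * (of_int \<epsilon> / 3 * (1/3)) \<in> (\<int> :: rat set)" by (metis Ints_of_int)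
    have "cubic_norm a b (1/3) (of_int \<epsilon> / 3) (1/3) = (of_int (3 * j\<^sup>2) :: rat)"
      using a(2) by (auto simp: cubic_norm_def b aj field_simps power2_eq_square power3_eq_cube)
    thus "cubic_norm a b (1/3) (of_int \<epsilon> / 3) (1/3) \<in> (\<int> :: rat set)" by (metis Ints_of_int)
  qed simp
  moreover have "elt (1/3) (of_int \<epsilon> / 3) (1/3) \<in> rat_adjoin A"
    by (rule elt_in_rat_adjoin)
  ultimately have "elt (1/3) (of_int \<epsilon> / 3) (1/3) \<in> int_adjoin (elt r s t)"
    unfolding gen[symmetric] by (simp add: ring_of_integers_def)
  then obtain p q :: int where "1 / 3 = of_int p * t + of_int q * (2 * r * t + of_nat b * s\<^sup>2)"
    using int_adjoin_coordinates[OF generator_integers[OF gen]] by metis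
  hence q: "3 * of_int q * s\<^sup>2 = 1" by (simp add: b t)
  show False
    using e
  proof
    assume "e = 1"
    hence "of_int (3 * q * x\<^sup>2) = (of_int 1 :: rat)" using q xy by simp
    hence "3 * (q * x\<^sup>2) = 1" by (simp only: of_int_eq_iff mult.assoc)
    thus False by presburger
  next
    assume "e = 3 \<and> \<not> 3 dvd a * b"
    hence s: "s = of_int x / 3" using xy by simp
    have "of_int (q * x\<^sup>2) = (of_int 3 :: rat)" using q by (simp add: s field_simps power2_eq_square)
    hence qx: "q * x\<^sup>2 = 3" by (simp only: of_int_eq_iff)
    have "of_int (I * x ^ 3) = (of_int 27 :: rat)" using I by (simp add: s field_simps power3_eq_cube)
    hence Ix: "I * x ^ 3 = 27" by (simp only: of_int_eq_iff)
    have "\<bar>x\<bar> = 1"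
    proof -
      have "\<not> 3 dvd x"
      proof
        assume "3 dvd x"
        then obtain z where "x = 3 * z" by auto
        hence "3 * (q * z\<^sup>2) = 1" using qx by (simp add: power2_eq_square)
        thus False by presburger
      qed
      moreover have "x ^ 3 dvd 27" using Ix by (metis dvd_triv_right)
      hence "x dvd 27" by (meson dvd_power dvd_trans zero_less_numeral)
      ultimately have "is_unit x" by (rule int_dvd_27_not_3_dvd_unit[rotated])
      thus ?thesis by simp
    qed
    hence x6: "x ^ 3 * x ^ 3 = 1" by (auto simp: abs_if split: if_splits)
    hence s6: "of_int x ^ 3 * of_int x ^ 3 = (1 :: rat)" by (metis of_int_1 of_int_mult of_int_power)
    have r: "r \<in> \<int>"
    proof -
      have "3 * r \<in> \<int>" "3 * r\<^sup>2 \<in> \<int>" using generator_integers[OF gen] by (simp_all add: t)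
      then obtain u v where uv: "3 * r = of_int u" "3 * r\<^sup>2 = of_int v" by (auto elim!: Ints_cases)
      have "(of_int (u\<^sup>2) :: rat) = of_int (3 * v)" by (simp flip: uv add: power2_eq_square)
      hence "u\<^sup>2 = 3 * v" by (simp only: of_int_eq_iff)
      hence "3 dvd u\<^sup>2" by simp
      hence "3 dvd u" by (simp add: prime_dvd_power_iff)
      then obtain w where "u = 3 * w" by auto
      hence "r = of_int w" using uv by simp
      thus ?thesis by simp
    qed
    have "cubic_norm a b r s t - r ^ 3 \<in> \<int>"
      using r generator_integers(3)[OF gen] by simp
    moreover have "cubic_norm a b r s t - r ^ 3 = of_nat a * s ^ 3"
      by (simp add: cubic_norm_def b t)
    ultimately obtain n where n: "of_nat a * s ^ 3 = of_int n" by (auto elim!: Ints_cases)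
    have "of_int (int a) = (of_int (27 * (n * x ^ 3)) :: rat)"
    proof -
      have "of_int (27 * (n * x ^ 3)) = 27 * (of_nat a * s ^ 3) * of_int x ^ 3" unfolding n by simp
      also have "\<dots> = of_nat a * (of_int x ^ 3 * of_int x ^ 3)" by (simp add: s power_divide)
      finally show ?thesis unfolding s6 by simp
    qed
    hence "int a = 27 * (n * x ^ 3)" by (simp only: of_int_eq_iff)
    hence "3\<^sup>2 dvd int a" by (intro dvdI[of _ _ "3 * (n * x ^ 3)"]) simp
    thus False using prime_not_square_dvd_squarefree[OF squarefree_a, of 3] by simp
  qed
qed

end

text \<open>
  If \<open>y\<close> vanished, \<open>c\<close> would be a unit and hence \<open>k = 1\<close>, which leaves only the case of the congruence modulo 9.
  The sign of \<open>(x, y, c)\<close> can be chosen so that \<open>y\<close> is positive.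
\<close>

lemma monogenic_pure_cubic_imp_thue:
  fixes k m :: nat
  assumes k: "squarefree k" and m: "squarefree m" "coprime m k" "m > 1"
    and mono: "monogenic (pure_cubic_field (k\<^sup>2 * m))"
    and cases: "k \<ge> 2 \<or> [int (k\<^sup>2 * m) = 1] (mod 9) \<or> [int (k\<^sup>2 * m) = -1] (mod 9)"
  obtains x y c :: int where "int k * x ^ 3 - int m * y ^ 3 = c" "c dvd 27" "coprime c (int m * y)" "y > 0"
proof -
  define \<alpha> \<beta> where "\<alpha> = root 3 (real k)" and "\<beta> = root 3 (real m)"
  have cube: "\<alpha> ^ 3 = real k" "\<beta> ^ 3 = real m" by (simp_all add: \<alpha>_def \<beta>_def)
  have rt: "root 3 (real (k\<^sup>2 * m)) = \<alpha>\<^sup>2 * \<beta>"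
    by (simp add: \<alpha>_def \<beta>_def real_root_mult real_root_power)
  have k0: "k > 0" using k by (cases "k = 0") auto
  interpret cubic_pair m k "complex_of_real (\<alpha>\<^sup>2 * \<beta>)" "complex_of_real (\<beta>\<^sup>2 * \<alpha>)"
  proof
    show "m * k > 1" using m(3) k0 by (metis less_1_mult less_one linorder_neqE_nat mult.right_neutral not_less_zero)
    have "(\<alpha>\<^sup>2 * \<beta>)\<^sup>2 = \<alpha> ^ 3 * (\<beta>\<^sup>2 * \<alpha>)" "(\<alpha>\<^sup>2 * \<beta>) * (\<beta>\<^sup>2 * \<alpha>) = \<beta> ^ 3 * \<alpha> ^ 3"
      "(\<beta>\<^sup>2 * \<alpha>)\<^sup>2 = \<beta> ^ 3 * (\<alpha>\<^sup>2 * \<beta>)"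
      by (simp_all add: power2_eq_square power3_eq_cube)
    note * = this[unfolded cube]
    show "(complex_of_real (\<alpha>\<^sup>2 * \<beta>))\<^sup>2 = of_nat k * complex_of_real (\<beta>\<^sup>2 * \<alpha>)"
      unfolding of_real_power[symmetric] * by simp
    show "complex_of_real (\<alpha>\<^sup>2 * \<beta>) * complex_of_real (\<beta>\<^sup>2 * \<alpha>) = of_nat (m * k)"
      unfolding of_real_mult[symmetric] * by simp
    show "(complex_of_real (\<beta>\<^sup>2 * \<alpha>))\<^sup>2 = of_nat m * complex_of_real (\<alpha>\<^sup>2 * \<beta>)"
      unfolding of_real_power[symmetric] * by simp
  qed (use k m in auto)
  have K: "pure_cubic_field (k\<^sup>2 * m) = rat_adjoin (complex_of_real (\<alpha>\<^sup>2 * \<beta>))"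
    by (simp only: pure_cubic_field_def rt)
  obtain \<theta> where "\<theta> \<in> ring_of_integers (rat_adjoin (complex_of_real (\<alpha>\<^sup>2 * \<beta>)))"
    and gen: "ring_of_integers (rat_adjoin (complex_of_real (\<alpha>\<^sup>2 * \<beta>))) = int_adjoin \<theta>"
    using mono unfolding K monogenic_def by blast
  then obtain r s t where \<theta>: "\<theta> = elt r s t"
    using rat_adjoin_elt unfolding ring_of_integers_def by (metis (no_types, lifting) mem_Collect_eq)
  obtain x y c :: int where xyc: "int k * x ^ 3 - int m * y ^ 3 = c" "c dvd 27" "coprime c (int m * y)"
    "y = 0 \<longleftrightarrow> t = 0"
    by (rule generator_thue_equation[OF gen[unfolded \<theta>]])
  have "y \<noteq> 0"
  proof
    assume y: "y = 0"
    hence "is_unit c" using xyc(3) by simp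
    hence "is_unit (int k * x ^ 3)" using xyc(1) y by simp
    hence "is_unit (int k)" by (rule dvd_mult_left)
    hence "k = 1" by simp
    thus False
      using generator_B_coordinate_nonzero[OF gen[unfolded \<theta>]] cases y xyc(4) by auto
  qed
  then consider "y > 0" | "- y > 0" by linarith
  thus ?thesis
  proof cases
    case 1
    thus ?thesis using that xyc by blast
  next
    case 2
    have "int k * (- x) ^ 3 - int m * (- y) ^ 3 = - c" using xyc(1) by simp
    moreover have "- c dvd 27" "coprime (- c) (int m * (- y))" using xyc(2,3) by simp_all
    ultimately show ?thesis using that 2 by blast
  qed
qed

section \<open>Cubic congruences and numbers of prime divisors\<close>

lemma prime_power_dvd_mult_cases:
  fixes p x y :: int
  assumes p: "Factorial_Ring.prime p" and dvd: "p ^ e dvd x * y" and "\<not> (p dvd x \<and> p dvd y)"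
  shows "p ^ e dvd x \<or> p ^ e dvd y"
proof -
  have cop: "coprime (p ^ e) z" if "\<not> p dvd z" for z
    using prime_imp_coprime[OF p that] by simp
  from assms(3) consider "\<not> p dvd x" | "\<not> p dvd y" by blast
  thus ?thesis
    using cop dvd by cases (simp_all add: coprime_dvd_mult_right_iff coprime_dvd_mult_left_iff)
qed

text \<open>
  Let \<open>u\<close> be one solution. For any other, \<open>p\<^sup>e\<close> divides \<open>(x - u) (x\<^sup>2 + x u + u\<^sup>2)\<close>. If \<open>p \<noteq> 3\<close>, then \<open>p\<close> cannot divide both
  factors, and the same reasoning applied to the quadratic factor with a root \<open>v\<close> leaves the classes of \<open>v\<close> and
  \<open>- u - v\<close>. If \<open>p = 3\<close>, then \<open>x\<close> and \<open>u\<close> agree modulo 3, and then modulo \<open>3\<^sup>e\<^sup>-\<^sup>1\<close>.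
\<close>

lemma cube_congruence_mod_prime_power:
  fixes k c p :: int
  assumes p: "Factorial_Ring.prime p" and e: "e > 0" and pc: "\<not> p dvd c"
  obtains u v w where "\<And>x. p ^ e dvd k * x ^ 3 - c \<Longrightarrow> p ^ e dvd x - u \<or> p ^ e dvd x - v \<or> p ^ e dvd x - w"
proof (cases "\<exists>u. p ^ e dvd k * u ^ 3 - c")
  case False
  thus ?thesis by (intro that[of 0 0 0]) blast
next
  case True
  then obtain u where u: "p ^ e dvd k * u ^ 3 - c" by blast
  have p_dvd: "p dvd z" if "p ^ e dvd z" for z
    using that e by (metis dvd_power dvd_trans)
  have "\<not> p dvd k * u ^ 3"
  proof
    assume "p dvd k * u ^ 3"
    hence "p dvd k * u ^ 3 - (k * u ^ 3 - c)" using p_dvd[OF u] by (rule dvd_diff)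
    thus False using pc by simp
  qed
  hence pk: "\<not> p dvd k" and pu: "\<not> p dvd u" using p by (auto simp: prime_dvd_mult_iff prime_dvd_power_iff)
  have cube: "p ^ e dvd (x - u) * (x\<^sup>2 + x * u + u\<^sup>2)" if x: "p ^ e dvd k * x ^ 3 - c" for x
  proof -
    have "p ^ e dvd (k * x ^ 3 - c) - (k * u ^ 3 - c)" using x u by (rule dvd_diff)
    also have "(k * x ^ 3 - c) - (k * u ^ 3 - c) = k * ((x - u) * (x\<^sup>2 + x * u + u\<^sup>2))"
      by (simp add: algebra_simps power2_eq_square power3_eq_cube)
    finally have "p ^ e dvd k * ((x - u) * (x\<^sup>2 + x * u + u\<^sup>2))" .
    moreover have "coprime (p ^ e) k" using prime_imp_coprime[OF p pk] by simp
    ultimately show ?thesis by (simp only: coprime_dvd_mult_right_iff)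
  qed
  show ?thesis
  proof (cases "p = 3")
    case False
    have p3: "\<not> p dvd 3 * u\<^sup>2"
    proof
      assume "p dvd 3 * u\<^sup>2"
      hence "p dvd 3" using pu p by (simp add: prime_dvd_mult_iff prime_dvd_power_iff)
      hence "p = 3" using p by (simp add: primes_dvd_imp_eq)
      thus False using False by simp
    qed
    have split: "p ^ e dvd x - u \<or> p ^ e dvd x\<^sup>2 + x * u + u\<^sup>2" if x: "p ^ e dvd k * x ^ 3 - c" for x
    proof (rule prime_power_dvd_mult_cases[OF p cube[OF x]])
      show "\<not> (p dvd x - u \<and> p dvd x\<^sup>2 + x * u + u\<^sup>2)"
      proof
        assume "p dvd x - u \<and> p dvd x\<^sup>2 + x * u + u\<^sup>2"
        hence "p dvd (x\<^sup>2 + x * u + u\<^sup>2) - (x - u) * (x + 2 * u)" by simp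
        also have "\<dots> = 3 * u\<^sup>2" by (simp add: algebra_simps power2_eq_square)
        finally show False using p3 by simp
      qed
    qed
    show ?thesis
    proof (cases "\<exists>v. p ^ e dvd v\<^sup>2 + v * u + u\<^sup>2")
      case False
      thus ?thesis using split by (intro that[of u u u]) blast
    next
      case True
      then obtain v where v: "p ^ e dvd v\<^sup>2 + v * u + u\<^sup>2" by blast
      show ?thesis
      proof (rule that[of u v "- u - v"])
        fix x assume x: "p ^ e dvd k * x ^ 3 - c"
        show "p ^ e dvd x - u \<or> p ^ e dvd x - v \<or> p ^ e dvd x - (- u - v)"
        proof (cases "p ^ e dvd x - u")
          case False
          hence "p ^ e dvd x\<^sup>2 + x * u + u\<^sup>2" using split[OF x] by blast
          hence "p ^ e dvd (x\<^sup>2 + x * u + u\<^sup>2) - (v\<^sup>2 + v * u + u\<^sup>2)" using v by (rule dvd_diff)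
          also have "\<dots> = (x - v) * (x - (- u - v))" by (simp add: algebra_simps power2_eq_square)
          finally have "p ^ e dvd (x - v) * (x - (- u - v))" .
          hence "p ^ e dvd x - v \<or> p ^ e dvd x - (- u - v)"
          proof (rule prime_power_dvd_mult_cases[OF p])
            show "\<not> (p dvd x - v \<and> p dvd x - (- u - v))"
            proof
              assume "p dvd x - v \<and> p dvd x - (- u - v)"
              hence "p dvd (x - (- u - v)) - (x - v)" by (metis dvd_diff)
              also have "(x - (- u - v)) - (x - v) = 2 * v + u" by simp
              finally have "p dvd 2 * v + u" .
              hence "p dvd 4 * (v\<^sup>2 + v * u + u\<^sup>2) - (2 * v + u) * (2 * v + u)"
                by (intro dvd_diff dvd_mult p_dvd[OF v])
              also have "\<dots> = 3 * u\<^sup>2" by (simp add: algebra_simps power2_eq_square)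
              finally show False using p3 by simp
            qed
          qed
          thus ?thesis by blast
        qed simp
      qed
    qed
  next
    case True
    obtain f where f: "e = Suc f" using e by (cases e) auto
    show ?thesis
    proof (rule that[of u "u + 3 ^ f" "u + 2 * 3 ^ f"])
      fix x assume x: "p ^ e dvd k * x ^ 3 - c"
      have "3 dvd (x - u) * (x\<^sup>2 + x * u + u\<^sup>2)" using p_dvd[OF cube[OF x]] True by simp
      hence "3 dvd (x - u) * (x\<^sup>2 + x * u + u\<^sup>2) - 3 * (x * u * (x - u))"
        by (intro dvd_diff) auto
      also have "\<dots> = (x - u) ^ 3" by (simp add: algebra_simps power2_eq_square power3_eq_cube)
      finally have "3 dvd x - u" by (simp add: prime_dvd_power_iff)
      then obtain t where t: "x = u + 3 * t" by (metis add.commute diff_add_cancel dvdE)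
      have "3 ^ e dvd 3 * (3 * t) * (3 * (t\<^sup>2 + t * u) + u\<^sup>2)"
        using cube[OF x] unfolding True t by (simp add: algebra_simps power2_eq_square)
      moreover have "coprime (3 ^ e) (3 * (t\<^sup>2 + t * u) + u\<^sup>2)"
      proof -
        have "\<not> 3 dvd 3 * (t\<^sup>2 + t * u) + u\<^sup>2"
          using pu True by (simp add: dvd_add_right_iff prime_dvd_power_iff)
        hence "coprime 3 (3 * (t\<^sup>2 + t * u) + u\<^sup>2)" by (intro prime_imp_coprime) auto
        thus ?thesis by simp
      qed
      ultimately have "3 ^ e dvd 3 * (3 * t)" by (simp only: coprime_dvd_mult_left_iff)
      hence "3 ^ f dvd 3 * t" unfolding f power_Suc by (subst (asm) dvd_mult_cancel_left) simp
      then obtain n where n: "x - u = 3 ^ f * n" unfolding t by auto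
      define j where "j = n div 3"
      have "n = 3 * j \<or> n = 3 * j + 1 \<or> n = 3 * j + 2" unfolding j_def by presburger
      hence "x - u = 3 ^ e * j \<or> x - (u + 3 ^ f) = 3 ^ e * j \<or> x - (u + 2 * 3 ^ f) = 3 ^ e * j"
        using n unfolding f by (auto simp: algebra_simps)
      thus "p ^ e dvd x - u \<or> p ^ e dvd x - (u + 3 ^ f) \<or> p ^ e dvd x - (u + 2 * 3 ^ f)"
        unfolding True by (metis dvd_triv_left)
    qed
  qed
qed

text \<open>
  Splitting off one prime power at a time distributes \<open>S\<close> over three classes, in each of which the elements
  are pairwise incongruent modulo the remaining factor. Pairwise incongruent solutions, unlike
  complete sets of residues, can be passed to subsets, so that the induction hypothesis applies to each class.
\<close>

lemma card_cube_congruence_solutions: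
  fixes k c :: int and q :: nat
  assumes "q > 0" "coprime c (int q)" "finite S"
    and "\<And>x. x \<in> S \<Longrightarrow> int q dvd k * x ^ 3 - c"
    and "\<And>x y. x \<in> S \<Longrightarrow> y \<in> S \<Longrightarrow> int q dvd x - y \<Longrightarrow> x = y"
  shows "card S \<le> 3 ^ card (prime_factors q)"
  using assms
proof (induction q arbitrary: S rule: less_induct)
  case (less q)
  show ?case
  proof (cases "q = 1")
    case True
    hence "x = y" if "x \<in> S" "y \<in> S" for x y using less.prems(5)[OF that] by simp
    hence "card S \<le> 1" using less.prems(3) by (simp add: card_le_Suc0_iff_eq)
    thus ?thesis using True by simp
  next
    case False
    then obtain p where p: "Factorial_Ring.prime p" "p dvd q" using prime_factor_nat by blast
    define e where "e = multiplicity p q"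
    obtain q' where q': "q = p ^ e * q'" "\<not> p dvd q'"
      using multiplicity_decompose'[of q p] less.prems(1) p(1) unfolding e_def
      by (metis less_numeral_extra(3) not_prime_unit)
    have e: "e > 0" using p less.prems(1) unfolding e_def by (simp add: prime_multiplicity_gt_zero_iff)
    have q'0: "q' > 0" using q' less.prems(1) by (cases "q' = 0") auto
    have pe: "p ^ e > 1" using prime_gt_1_nat[OF p(1)] e by (rule one_less_power)
    have q'q: "q' < q" using q'0 pe unfolding q'(1) by simp
    have cop: "coprime (p ^ e) q'" using prime_imp_coprime[OF p(1) q'(2)] by simp
    have pf: "prime_factors q = insert p (prime_factors q')"
    proof -
      have "prime_factors (p ^ e * q') = prime_factors (p ^ e) \<union> prime_factors q'"
        using p(1) q'0 by (intro prime_factors_product) auto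
      thus ?thesis using q'(1) p(1) e by (simp add: prime_factorization_prime_power)
    qed
    have "p \<notin> prime_factors q'" using q'(2) by auto
    hence cpf: "card (prime_factors q) = Suc (card (prime_factors q'))" unfolding pf by simp
    have pc: "\<not> int p dvd c"
    proof
      assume "int p dvd c"
      moreover have "int p dvd int q" using p(2) by (simp only: of_nat_dvd_iff)
      ultimately have "is_unit (int p)" using less.prems(2) by (meson coprime_common_divisor)
      thus False using p(1) by simp
    qed
    have ip: "Factorial_Ring.prime (int p)" using p(1) by simp
    obtain u v w where uvw: "\<And>x. int p ^ e dvd k * x ^ 3 - c \<Longrightarrow>
        int p ^ e dvd x - u \<or> int p ^ e dvd x - v \<or> int p ^ e dvd x - w"
      using cube_congruence_mod_prime_power[OF ip e pc] by metis
    define Y where "Y z = {x \<in> S. int p ^ e dvd x - z}" for z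
    have card_Y: "card (Y z) \<le> 3 ^ card (prime_factors q')" for z
    proof (rule less.IH[OF q'q q'0])
      show "coprime c (int q')" using less.prems(2) unfolding q'(1) by simp
      show "finite (Y z)" using less.prems(3) by (simp add: Y_def)
      show "int q' dvd k * x ^ 3 - c" if "x \<in> Y z" for x
        using less.prems(4)[of x] that unfolding Y_def q'(1) by (auto dest: dvd_mult_right)
      show "x = y" if xy: "x \<in> Y z" "y \<in> Y z" and d: "int q' dvd x - y" for x y
      proof -
        have "int p ^ e dvd x - z" "int p ^ e dvd y - z" using xy unfolding Y_def by auto
        hence "int p ^ e dvd (x - z) - (y - z)" by (rule dvd_diff)
        hence "int (p ^ e) dvd x - y" by simp
        moreover have "coprime (int (p ^ e)) (int q')" using cop by (simp only: coprime_int_iff)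
        ultimately have "int (p ^ e) * int q' dvd x - y" using d by (rule_tac divides_mult)
        thus ?thesis using less.prems(5) xy unfolding Y_def q'(1) by simp
      qed
    qed
    have "S \<subseteq> Y u \<union> Y v \<union> Y w"
    proof
      fix x assume x: "x \<in> S"
      have "int p ^ e dvd k * x ^ 3 - c"
        using less.prems(4)[OF x] unfolding q'(1) by (auto dest: dvd_mult_left)
      thus "x \<in> Y u \<union> Y v \<union> Y w" using uvw[of x] x unfolding Y_def by blast
    qed
    moreover have "finite (Y u \<union> Y v \<union> Y w)" using less.prems(3) by (simp add: Y_def)
    ultimately have "card S \<le> card (Y u \<union> Y v \<union> Y w)" by (rule card_mono[rotated])
    also have "\<dots> \<le> card (Y u) + card (Y v) + card (Y w)"
      by (meson card_Un_le add_le_mono1 order_trans)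
    also have "\<dots> \<le> 3 ^ card (prime_factors q)"
      using card_Y[of u] card_Y[of v] card_Y[of w] unfolding cpf by simp
    finally show ?thesis .
  qed
qed

text \<open>
  The interval is cut into blocks of \<open>q\<close> consecutive integers, numbered by \<open>(x + L) div q\<close>.
\<close>

lemma card_cube_congruence_interval:
  fixes k c :: int and q L :: nat
  assumes q: "q > 0" "coprime c (int q)"
  shows "card {x. \<bar>x\<bar> \<le> int L \<and> int q dvd k * x ^ 3 - c} \<le> (2 * L div q + 1) * 3 ^ card (prime_factors q)"
proof -
  define S where "S j = {x. \<bar>x\<bar> \<le> int L \<and> int q dvd k * x ^ 3 - c \<and> (x + int L) div int q = int j}" for j
  have fin: "finite (S j)" for j
    by (rule finite_subset[of _ "{- int L..int L}"]) (auto simp: S_def)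
  have card_X: "card (S j) \<le> 3 ^ card (prime_factors q)" for j
  proof (rule card_cube_congruence_solutions[OF q fin])
    show "int q dvd k * x ^ 3 - c" if "x \<in> S j" for x using that by (simp add: S_def)
    show "x = y" if xy: "x \<in> S j" "y \<in> S j" and d: "int q dvd x - y" for x y
    proof -
      have "int q dvd (x + int L) - (y + int L)" using d by simp
      hence "(x + int L) mod int q = (y + int L) mod int q" by (simp only: mod_eq_dvd_iff)
      moreover have "(x + int L) div int q = (y + int L) div int q" using xy by (simp add: S_def)
      ultimately have "x + int L = y + int L" by (metis div_mult_mod_eq)
      thus ?thesis by simp
    qed
  qed
  have "{x. \<bar>x\<bar> \<le> int L \<and> int q dvd k * x ^ 3 - c} \<subseteq> (\<Union>j\<in>{..2 * L div q}. S j)"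
  proof
    fix x assume "x \<in> {x. \<bar>x\<bar> \<le> int L \<and> int q dvd k * x ^ 3 - c}"
    hence x: "\<bar>x\<bar> \<le> int L" "int q dvd k * x ^ 3 - c" by auto
    define z where "z = nat (x + int L)"
    have z: "x + int L = int z" "z \<le> 2 * L" using x(1) by (auto simp: z_def)
    have "x \<in> S (z div q)" using x z(1) by (simp add: S_def zdiv_int)
    moreover have "z div q \<le> 2 * L div q" using z(2) by (rule div_le_mono)
    ultimately show "x \<in> (\<Union>j\<in>{..2 * L div q}. S j)" by blast
  qed
  hence "card {x. \<bar>x\<bar> \<le> int L \<and> int q dvd k * x ^ 3 - c} \<le> card (\<Union>j\<in>{..2 * L div q}. S j)"
    by (intro card_mono) (auto simp: fin)
  also have "\<dots> \<le> (\<Sum>j\<in>{..2 * L div q}. card (S j))" by (rule card_UN_le) simp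
  also have "\<dots> \<le> (\<Sum>j\<in>{..2 * L div q}. 3 ^ card (prime_factors q))" by (intro sum_mono card_X)
  finally show ?thesis by simp
qed

lemma prod_prime_factors_dvd:
  fixes n :: "'a :: factorial_semiring_multiplicative"
  assumes "n \<noteq> 0"
  shows "\<Prod>(prime_factors n) dvd n"
proof -
  have "\<Prod>(prime_factors n) dvd (\<Prod>p\<in>prime_factors n. p ^ multiplicity p n)"
    by (intro prod_dvd_prod dvd_power) (auto simp: prime_factors_multiplicity)
  also have "\<dots> = normalize n" using assms by (rule prod_prime_factors)
  finally show ?thesis by simp
qed

text \<open>
  Primes \<open>p\<close> with \<open>p powr \<eta> \<ge> 3\<close> contribute at most \<open>p powr \<eta>\<close> each, and there are at most \<open>P\<close> others.
\<close>

lemma three_power_card_prime_factors_bound: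
  fixes \<eta> :: real
  assumes "\<eta> > 0"
  shows "\<exists>C\<ge>1. \<forall>n::nat. n > 0 \<longrightarrow> real (3 ^ card (prime_factors n)) \<le> C * real n powr \<eta>"
proof -
  define P where "P = nat \<lceil>3 powr (1 / \<eta>)\<rceil>"
  have P: "3 \<le> real p powr \<eta>" if "p \<ge> P" for p :: nat
  proof -
    have "3 powr (1 / \<eta>) \<le> real p" using that unfolding P_def by linarith
    hence "(3 powr (1 / \<eta>)) powr \<eta> \<le> real p powr \<eta>" using assms by (intro powr_mono2) auto
    thus ?thesis using assms by (simp add: powr_powr)
  qed
  show ?thesis
  proof (intro exI[of _ "3 ^ P"] conjI allI impI)
    fix n :: nat assume n: "n > 0"
    define F where "F = prime_factors n"
    have "card (F \<inter> {..<P}) \<le> card {..<P}" by (intro card_mono) auto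
    hence small: "card (F \<inter> {..<P}) \<le> P" by simp
    have "card F = card (F \<inter> {..<P}) + card (F - {..<P})"
      unfolding F_def by (subst card_Int_Diff[of _ "{..<P}"]) auto
    hence "real (3 ^ card F) = 3 ^ card (F \<inter> {..<P}) * 3 ^ card (F - {..<P})"
      by (simp add: power_add)
    also have "\<dots> \<le> 3 ^ P * (\<Prod>p\<in>F - {..<P}. real p powr \<eta>)"
    proof (rule mult_mono)
      have "(\<Prod>p\<in>F - {..<P}. (3::real)) \<le> (\<Prod>p\<in>F - {..<P}. real p powr \<eta>)"
        by (intro prod_mono) (auto intro: P)
      thus "3 ^ card (F - {..<P}) \<le> (\<Prod>p\<in>F - {..<P}. real p powr \<eta>)" by simp
    qed (use small in \<open>auto intro: power_increasing\<close>)
    also have "(\<Prod>p\<in>F - {..<P}. real p powr \<eta>) \<le> (\<Prod>p\<in>F. real p powr \<eta>)"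
    proof (rule prod_mono2)
      fix p assume "p \<in> F - (F - {..<P})"
      hence "Factorial_Ring.prime p" unfolding F_def by auto
      hence "p \<ge> 1" by (rule prime_ge_1_nat)
      thus "1 \<le> real p powr \<eta>" using assms by (intro ge_one_powr_ge_zero) auto
    qed (auto simp: F_def)
    also have "\<dots> = real (\<Prod>F) powr \<eta>"
      unfolding of_nat_prod by (rule prod_powr_distrib[symmetric])
    also have "\<dots> \<le> real n powr \<eta>"
    proof (rule powr_mono2)
      have "\<Prod>F \<le> n" unfolding F_def using n by (intro dvd_imp_le prod_prime_factors_dvd) auto
      thus "real (\<Prod>F) \<le> real n" by (rule of_nat_mono)
    qed (use assms in \<open>auto intro: prod_nonneg\<close>)
    finally show "real (3 ^ card (prime_factors n)) \<le> 3 ^ P * real n powr \<eta>" unfolding F_def by simp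
  qed simp
qed

text \<open>
  Comparison with the telescoping sum of \<open>1 / (y (y - 1))\<close>.
\<close>

lemma sum_inverse_squares_le:
  fixes M :: nat
  shows "(\<Sum>y=1..M. 1 / (real y)\<^sup>2) \<le> 2"
proof -
  have "M > 0 \<Longrightarrow> (\<Sum>y=1..M. 1 / (real y)\<^sup>2) \<le> 2 - 1 / real M"
  proof (induction M)
    case (Suc M)
    show ?case
    proof (cases "M = 0")
      case False
      have "1 / (real (Suc M))\<^sup>2 \<le> 1 / (real M * real (Suc M))"
        using False by (intro divide_left_mono) (auto simp: power2_eq_square)
      also have "\<dots> = 1 / real M - 1 / real (Suc M)" using False by (simp add: field_simps)
      finally show ?thesis using Suc False by simp
    qed simp
  qed simp
  thus ?thesis by (cases "M = 0") (auto intro: order_trans)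
qed

section \<open>The size of solutions under the ABC conjecture\<close>

lemma thue_solution_size:
  fixes k m :: nat and x y c :: int
  assumes eq: "int k * x ^ 3 - int m * y ^ 3 = c" and "k > 0" "m > 0" "y > 0" "\<bar>c\<bar> \<le> 27"
  shows "real_of_int \<bar>x\<bar> \<le> 4 * real m powr (1/3) * real_of_int y"
proof (rule power_le_imp_le_base)
  have "m * y ^ 3 > 0" using assms by simp
  have "\<bar>x\<bar> ^ 3 \<le> int k * \<bar>x\<bar> ^ 3" using assms(2) by (simp add: mult_le_cancel_right1)
  also have "\<dots> = \<bar>c + int m * y ^ 3\<bar>" using eq by (simp add: abs_mult power_abs flip: eq)
  also have "\<dots> \<le> 27 + int m * y ^ 3" using assms \<open>m * y ^ 3 > 0\<close> by linarith
  also have "\<dots> \<le> 64 * (int m * y ^ 3)" using \<open>m * y ^ 3 > 0\<close> by linarith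
  finally have "real_of_int (\<bar>x\<bar> ^ 3) \<le> real_of_int (64 * (int m * y ^ 3))" by (simp only: of_int_le_iff)
  also have "\<dots> = 64 * (real m * real_of_int y ^ 3)" by simp
  also have "real m = (real m powr (1/3)) ^ Suc 2" using assms(3)
    by (subst powr_realpow[symmetric]) (auto simp: powr_powr)
  also have "64 * ((real m powr (1/3)) ^ Suc 2 * real_of_int y ^ 3) = (4 * real m powr (1/3) * real_of_int y) ^ Suc 2"
    by (simp add: power_mult_distrib)
  finally show "real_of_int \<bar>x\<bar> ^ Suc 2 \<le> (4 * real m powr (1/3) * real_of_int y) ^ Suc 2"
    by simp
qed (use assms in auto)

lemma int_radical_le:
  fixes n n' :: int
  assumes "n' \<noteq> 0" "\<And>p. Factorial_Ring.prime p \<Longrightarrow> p dvd n \<Longrightarrow> p dvd n'"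
  shows "(\<Prod>p | Factorial_Ring.prime p \<and> p dvd n. p) \<le> \<bar>n'\<bar>"
proof -
  have "(\<Prod>p | Factorial_Ring.prime p \<and> p dvd n. p) \<le> \<Prod>(prime_factors n')"
  proof (rule prod_mono2)
    show "{p. Factorial_Ring.prime p \<and> p dvd n} \<subseteq> prime_factors n'"
      using assms by (auto simp: in_prime_factors_iff)
    show "1 \<le> p" if "p \<in> prime_factors n' - {p. Factorial_Ring.prime p \<and> p dvd n}" for p
      using that prime_ge_1_int[of p] by auto
  qed (auto simp: prime_ge_0_int)
  also have "\<dots> \<le> \<bar>\<Prod>(prime_factors n')\<bar>" by simp
  also have "\<dots> \<le> \<bar>n'\<bar>" using assms(1) by (intro dvd_imp_le_int prod_prime_factors_dvd)
  finally show ?thesis .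
qed

text \<open>
  Solving the radical inequality for \<open>Y\<close>. With this \<open>\<delta>\<close>, the factor \<open>1 - 2 \<delta>\<close> left over on \<open>Y\<close> is the
  inverse of \<open>1 + \<epsilon>/2\<close>, and the exponent of \<open>M\<close> becomes \<open>1/3 + \<epsilon>/2\<close> exactly.
\<close>

lemma abc_radical_inequality_exponent:
  fixes \<epsilon> \<delta> C D M Y :: real
  assumes \<epsilon>: "\<epsilon> > 0" and \<delta>: "\<delta> = \<epsilon> / (2 * (2 + \<epsilon>))" and pos: "C > 0" "D > 0" "M > 0" "Y > 0"
    and le: "M * Y ^ 3 \<le> C * (D * M powr (4/3) * Y\<^sup>2) powr (1 + \<delta>)"
  shows "Y \<le> (C * D powr (1 + \<delta>)) powr (1 + \<epsilon> / 2) * M powr (1/3 + \<epsilon>/2)"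
proof -
  have d: "\<delta> * \<epsilon> = \<epsilon> / 2 - 2 * \<delta>"
  proof -
    have "\<delta> * (2 * (2 + \<epsilon>)) = \<epsilon>" using \<epsilon> unfolding \<delta> by simp
    thus ?thesis by (simp add: algebra_simps)
  qed
  have e1: "(1 - 2 * \<delta>) * (1 + \<epsilon> / 2) = 1"
    using d by (simp add: algebra_simps)
  have "(1/3 + \<epsilon>/2) * (1 - 2 * \<delta>) = 1/3 + \<epsilon>/2 - 2/3 * \<delta> - \<delta> * \<epsilon>"
    by (simp add: algebra_simps)
  also have "\<dots> = 4/3 * (1 + \<delta>) - 1" unfolding d by (simp add: add_divide_distrib)
  finally have "4/3 * (1 + \<delta>) - 1 = (1/3 + \<epsilon>/2) * (1 - 2 * \<delta>)" ..
  hence e2: "(4/3 * (1 + \<delta>) - 1) * (1 + \<epsilon> / 2) = 1/3 + \<epsilon>/2"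
    by (simp only: mult.assoc e1 mult_1_right)
  have l: "M * Y ^ 3 = M powr 1 * (Y powr (1 - 2 * \<delta>) * Y powr (2 * (1 + \<delta>)))"
    using pos by (simp flip: powr_add powr_numeral)
  have r: "C * (D * M powr (4/3) * Y\<^sup>2) powr (1 + \<delta>)
     = C * D powr (1 + \<delta>) * (M powr (4/3 * (1 + \<delta>) - 1) * M powr 1) * Y powr (2 * (1 + \<delta>))"
  proof -
    have "Y\<^sup>2 = Y powr 2" using pos by (simp add: powr_numeral)
    hence "Y\<^sup>2 powr (1 + \<delta>) = Y powr (2 * (1 + \<delta>))" by (simp only: powr_powr)
    moreover have "M powr (4/3 * (1 + \<delta>) - 1) * M powr 1 = M powr (4/3 * (1 + \<delta>))"
      by (simp only: powr_add[symmetric]) simp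
    ultimately show ?thesis using pos by (simp add: powr_mult powr_powr)
  qed
  have "(M powr 1 * Y powr (2 * (1 + \<delta>))) * Y powr (1 - 2 * \<delta>)
     \<le> (M powr 1 * Y powr (2 * (1 + \<delta>))) * (C * D powr (1 + \<delta>) * M powr (4/3 * (1 + \<delta>) - 1))"
    using le unfolding l r by (simp only: mult_ac)
  hence "Y powr (1 - 2 * \<delta>) \<le> C * D powr (1 + \<delta>) * M powr (4/3 * (1 + \<delta>) - 1)"
    using pos by (subst (asm) mult_le_cancel_left_pos) auto
  hence "(Y powr (1 - 2 * \<delta>)) powr (1 + \<epsilon> / 2)
     \<le> (C * D powr (1 + \<delta>) * M powr (4/3 * (1 + \<delta>) - 1)) powr (1 + \<epsilon> / 2)"
    using \<epsilon> by (intro powr_mono2) auto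
  thus ?thesis using pos by (simp only: powr_powr e1 powr_mult e2) simp
qed

text \<open>
  The radical of \<open>k x\<^sup>3 * m y\<^sup>3 * c\<close> divides \<open>3 k x m y\<close>, and the size of \<open>x\<close> is known from the equation; so the radical
  is at most \<open>12 k m\<^sup>4\<^sup>/\<^sup>3 y\<^sup>2\<close>, to be compared with \<open>m y\<^sup>3\<close>.
\<close>

lemma abc_imp_thue_solution_bound:
  fixes \<epsilon> :: real and k :: nat
  assumes abc: abc_conjecture and \<epsilon>: "\<epsilon> > 0" and k: "k > 0"
  shows "\<exists>C\<ge>1. \<forall>(m::nat) x y c. m > 1 \<longrightarrow> y > 0 \<longrightarrow> int k * x ^ 3 - int m * y ^ 3 = c \<longrightarrow> c dvd 27 \<longrightarrow>
    coprime c (int m * y) \<longrightarrow> real_of_int y \<le> C * real m powr (1/3 + \<epsilon>/2)"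
proof -
  define \<delta> where "\<delta> = \<epsilon> / (2 * (2 + \<epsilon>))"
  have \<delta>: "\<delta> > 0" using \<epsilon> by (simp add: \<delta>_def)
  from abc[unfolded abc_conjecture_def, rule_format, OF \<delta>] obtain C where C: "C > 0"
    and abc_bound: "\<forall>a b c :: int. a \<noteq> 0 \<and> b \<noteq> 0 \<and> c \<noteq> 0 \<and> Gcd {a, b, c} = 1 \<and> a + b = c \<longrightarrow>
            real_of_int (Max {\<bar>a\<bar>, \<bar>b\<bar>, \<bar>c\<bar>})
              \<le> C * real_of_int (\<Prod>p | Factorial_Ring.prime p \<and> p dvd a * b * c. p) powr (1 + \<delta>)"
    by (elim exE conjE)
  note bound = abc_bound[rule_format, OF conjI[OF _ conjI[OF _ conjI[OF _ conjI]]]]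
  define D where "D = 12 * real k"
  define E where "E = (C * D powr (1 + \<delta>)) powr (1 + \<epsilon> / 2)"
  show ?thesis
  proof (intro exI[of _ "max 1 E"] conjI allI impI)
    fix m :: nat and x y c :: int
    assume m: "m > 1" and y: "y > 0" and eq: "int k * x ^ 3 - int m * y ^ 3 = c" and c: "c dvd 27"
      and cop: "coprime c (int m * y)"
    have c0: "c \<noteq> 0" using c by auto
    have x0: "x \<noteq> 0"
    proof
      assume "x = 0"
      hence "int m dvd c" using eq by auto
      hence "is_unit (int m)" using cop by (meson coprime_common_divisor dvd_triv_left)
      thus False using m by simp
    qed
    have "Gcd {int k * x ^ 3, - (int m * y ^ 3), c} = 1"
    proof -
      let ?g = "Gcd {int k * x ^ 3, - (int m * y ^ 3), c}"
      have "coprime c (int m * y ^ 3)" using cop by simp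
      moreover have "?g dvd c" by (rule Gcd_dvd) simp
      moreover have "?g dvd - (int m * y ^ 3)" by (rule Gcd_dvd) simp
      hence "?g dvd int m * y ^ 3" by (simp only: dvd_minus_iff)
      ultimately have "is_unit ?g" by (meson coprime_common_divisor)
      hence "\<bar>?g\<bar> = 1" by (simp only: zdvd1_eq)
      moreover have "?g \<ge> 0" by (rule Gcd_int_greater_eq_0)
      ultimately show ?thesis by linarith
    qed
    note le = bound[OF _ _ c0 this]
    have "real m * real_of_int y ^ 3 = real_of_int \<bar>- (int m * y ^ 3)\<bar>" using y by (simp add: abs_mult)
    also have "\<dots> \<le> real_of_int (Max {\<bar>int k * x ^ 3\<bar>, \<bar>- (int m * y ^ 3)\<bar>, \<bar>c\<bar>})"
      by (subst of_int_le_iff, rule Max_ge) auto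
    also have "\<dots> \<le> C * real_of_int (\<Prod>p | Factorial_Ring.prime p \<and> p dvd int k * x ^ 3 * - (int m * y ^ 3) * c. p) powr (1 + \<delta>)"
      using x0 k m y eq by (intro le) auto
    also have "\<dots> \<le> C * (D * real m powr (4/3) * (real_of_int y)\<^sup>2) powr (1 + \<delta>)"
    proof (intro mult_left_mono powr_mono2)
      have "(\<Prod>p | Factorial_Ring.prime p \<and> p dvd int k * x ^ 3 * - (int m * y ^ 3) * c. p) \<le> \<bar>3 * int k * x * (int m * y)\<bar>"
      proof (rule int_radical_le)
        show "3 * int k * x * (int m * y) \<noteq> 0" using x0 k m y by simp
        fix p :: int assume p: "Factorial_Ring.prime p" "p dvd int k * x ^ 3 * - (int m * y ^ 3) * c"
        have "p dvd 3" if "p dvd c"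
        proof -
          have "p dvd 3 ^ 3" using dvd_trans[OF that c] by simp
          thus ?thesis using p(1) prime_dvd_power by blast
        qed
        thus "p dvd 3 * int k * x * (int m * y)"
          using p by (auto simp: prime_dvd_mult_iff prime_dvd_power_iff)
      qed
      hence "real_of_int (\<Prod>p | Factorial_Ring.prime p \<and> p dvd int k * x ^ 3 * - (int m * y ^ 3) * c. p)
        \<le> real_of_int \<bar>3 * int k * x * (int m * y)\<bar>" by (simp only: of_int_le_iff)
      also have "\<dots> = 3 * real k * real_of_int \<bar>x\<bar> * (real m * real_of_int y)"
        using y by (simp add: abs_mult)
      also have "\<dots> \<le> 3 * real k * (4 * real m powr (1/3) * real_of_int y) * (real m * real_of_int y)"
      proof (intro mult_left_mono mult_right_mono)
        have "\<bar>c\<bar> \<le> \<bar>27\<bar>" using c by (intro dvd_imp_le_int) auto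
        thus "real_of_int \<bar>x\<bar> \<le> 4 * real m powr (1/3) * real_of_int y"
          using m y k by (intro thue_solution_size[OF eq]) auto
      qed (use y in auto)
      also have "\<dots> = D * real m powr (4/3) * (real_of_int y)\<^sup>2"
      proof -
        have "real m powr (4/3) = real m powr (1/3) * real m"
          using m powr_add[of "real m" "1/3" 1] by simp
        thus ?thesis by (simp add: D_def power2_eq_square)
      qed
      finally show "real_of_int (\<Prod>p | Factorial_Ring.prime p \<and> p dvd int k * x ^ 3 * - (int m * y ^ 3) * c. p)
        \<le> D * real m powr (4/3) * (real_of_int y)\<^sup>2" .
      show "0 \<le> real_of_int (\<Prod>p | Factorial_Ring.prime p \<and> p dvd int k * x ^ 3 * - (int m * y ^ 3) * c. p)"
        by (subst of_int_0_le_iff, rule prod_nonneg) (auto simp: prime_ge_0_int)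
    qed (use C \<delta> in auto)
    finally have "real_of_int y \<le> E * real m powr (1/3 + \<epsilon>/2)"
      unfolding E_def using y m k C
      by (intro abc_radical_inequality_exponent[OF \<epsilon> \<delta>_def]) (auto simp: D_def)
    also have "\<dots> \<le> max 1 E * real m powr (1/3 + \<epsilon>/2)" by (intro mult_right_mono) auto
    finally show "real_of_int y \<le> max 1 E * real m powr (1/3 + \<epsilon>/2)" .
  qed simp
qed

section \<open>Counting\<close>

text \<open>
  The triples \<open>(c, y, x)\<close> form the set \<open>W\<close>. In the notation of the proof there are 55 values of \<open>c\<close>, at most \<open>M\<close> of \<open>y\<close>, and
  \<open>(8 T / y\<^sup>2 + 1) A M\<^sup>\<eta>\<close> of \<open>x\<close>; as \<open>T \<le> M\<close>, they add up to at most \<open>55 * 17 A M\<^sup>1\<^sup>+\<^sup>\<eta>\<close>. The choice of \<open>\<eta>\<close> turns the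
  exponent \<open>1/3 + \<epsilon>/2\<close> of \<open>N\<close> in \<open>M\<close> into \<open>1/3 + \<epsilon>\<close>.
\<close>

lemma card_thue_parameters_bound:
  fixes \<epsilon> C :: real and k :: nat
  assumes \<epsilon>: "\<epsilon> > 0" and C: "C \<ge> 1" and k: "k > 0"
  shows "\<exists>B>0. \<forall>(N::nat) S. N \<ge> 1 \<longrightarrow>
    (\<forall>m\<in>S. \<exists>x y c :: int. m > 0 \<and> int k * x ^ 3 - int m * y ^ 3 = c \<and> \<bar>c\<bar> \<le> 27 \<and> coprime c y \<and> y > 0
       \<and> real_of_int y \<le> C * real N powr (1/3 + \<epsilon>/2) \<and> real_of_int \<bar>x\<bar> \<le> 4 * real N powr (1/3) * real_of_int y) \<longrightarrow>
    real (card (S :: nat set)) \<le> B * real N powr (1/3 + \<epsilon>)"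
proof -
  define e where "e = 1/3 + \<epsilon>/2"
  define \<eta> where "\<eta> = \<epsilon> / (2 * e)"
  have e0: "e > 0" using \<epsilon> by (simp add: e_def)
  have \<eta>0: "\<eta> > 0" using \<epsilon> e0 by (simp add: \<eta>_def)
  have e\<eta>: "e * (1 + \<eta>) = 1/3 + \<epsilon>" using e0 by (simp add: \<eta>_def e_def[symmetric] algebra_simps) (simp add: e_def)
  obtain A where A: "A \<ge> 1" and omega: "\<And>n::nat. n > 0 \<Longrightarrow> real (3 ^ card (prime_factors n)) \<le> A * real n powr (\<eta> / 3)"
    using three_power_card_prime_factors_bound[of "\<eta> / 3"] \<eta>0 by auto
  show ?thesis
  proof (intro exI[of _ "935 * A * C powr (1 + \<eta>)"] conjI allI impI)
    show "935 * A * C powr (1 + \<eta>) > 0" using A C by simp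
    fix N :: nat and S :: "nat set"
    assume N: "N \<ge> 1" and S: "\<forall>m\<in>S. \<exists>x y c :: int. m > 0 \<and> int k * x ^ 3 - int m * y ^ 3 = c \<and> \<bar>c\<bar> \<le> 27 \<and> coprime c y \<and> y > 0
       \<and> real_of_int y \<le> C * real N powr (1/3 + \<epsilon>/2) \<and> real_of_int \<bar>x\<bar> \<le> 4 * real N powr (1/3) * real_of_int y"
    define M where "M = C * real N powr e"
    define T where "T = real N powr (1/3)"
    have T: "T \<ge> 1" using N unfolding T_def by (intro ge_one_powr_ge_zero) auto
    have "T \<le> real N powr e" unfolding T_def e_def using N \<epsilon> by (intro powr_mono) auto
    also have "\<dots> \<le> M" unfolding M_def using C by (simp add: mult_le_cancel_right1)
    finally have TM: "T \<le> M" .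
    define L where "L y = nat \<lfloor>4 * T * real y\<rfloor>" for y
    define R where "R c y = (if coprime c (int (y ^ 3)) then {x. \<bar>x\<bar> \<le> int (L y) \<and> int (y ^ 3) dvd int k * x ^ 3 - c} else {})"
      for c :: int and y :: nat
    define W where "W = Sigma ({-27..27} \<times> {1..nat \<lfloor>M\<rfloor>}) (\<lambda>(c, y). R c y)"
    have finR: "finite (R c y)" for c y
      by (rule finite_subset[of _ "{- int (L y)..int (L y)}"]) (auto simp: R_def)
    have finW: "finite W" unfolding W_def by (intro finite_SigmaI) (auto simp: finR)
    have cardR: "real (card (R c y)) \<le> (8 * T / (real y)\<^sup>2 + 1) * (A * M powr \<eta>)"
      if y: "y \<in> {1..nat \<lfloor>M\<rfloor>}" for c y
    proof (cases "coprime c (int (y ^ 3))")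
      case True
      have y1: "y \<ge> 1" "real y \<le> M" using y by (auto, linarith)
      have "card (R c y) \<le> (2 * L y div y ^ 3 + 1) * 3 ^ card (prime_factors (y ^ 3))"
        using card_cube_congruence_interval[of "y ^ 3" c "L y" "int k"] True y1(1) by (simp add: R_def)
      hence "real (card (R c y)) \<le> real ((2 * L y div y ^ 3 + 1) * 3 ^ card (prime_factors (y ^ 3)))"
        by (rule of_nat_mono)
      also have "\<dots> = (real (2 * L y div y ^ 3) + 1) * real (3 ^ card (prime_factors (y ^ 3)))"
        by (simp only: of_nat_mult of_nat_add of_nat_1)
      also have "\<dots> \<le> (8 * T / (real y)\<^sup>2 + 1) * (A * M powr \<eta>)"
      proof (intro mult_mono add_mono order_refl)
        have "real (2 * L y div y ^ 3) * real (y ^ 3) \<le> real (2 * L y)"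
          by (simp only: of_nat_mult[symmetric] of_nat_le_iff div_times_less_eq_dividend)
        hence "real (2 * L y div y ^ 3) \<le> real (2 * L y) / real (y ^ 3)"
          using y1 by (subst pos_le_divide_eq) auto
        also have "\<dots> \<le> 2 * (4 * T * real y) / real (y ^ 3)"
        proof (rule divide_right_mono)
          have "real (L y) \<le> 4 * T * real y" unfolding L_def using T by (intro of_nat_floor) simp
          thus "real (2 * L y) \<le> 2 * (4 * T * real y)" by (simp only: of_nat_mult of_nat_numeral)
        qed simp
        also have "\<dots> = 8 * T / (real y)\<^sup>2" using y1 by (simp add: power2_eq_square power3_eq_cube)
        finally show "real (2 * L y div y ^ 3) \<le> 8 * T / (real y)\<^sup>2" .
        have "real (3 ^ card (prime_factors (y ^ 3))) \<le> A * real (y ^ 3) powr (\<eta> / 3)"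
          using y1 by (intro omega) simp
        also have "real (y ^ 3) powr (\<eta> / 3) = real y powr \<eta>"
        proof -
          have "real (y ^ 3) = real y powr 3" using y1 by (simp add: powr_numeral)
          hence "real (y ^ 3) powr (\<eta> / 3) = real y powr (3 * (\<eta> / 3))" by (simp only: powr_powr)
          thus ?thesis by simp
        qed
        also have "A * real y powr \<eta> \<le> A * M powr \<eta>"
          using A y1 \<eta>0 by (intro mult_left_mono powr_mono2) auto
        finally show "real (3 ^ card (prime_factors (y ^ 3))) \<le> A * M powr \<eta>" .
      qed (use T in auto)
      finally show ?thesis .
    next
      case False
      thus ?thesis using A T by (simp add: R_def)
    qed
    have "S \<subseteq> (\<lambda>((c, y), x). nat ((int k * x ^ 3 - c) div int (y ^ 3))) ` W"
    proof
      fix m assume "m \<in> S"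
      with S obtain x y c where h: "m > 0" "int k * x ^ 3 - int m * y ^ 3 = c" "\<bar>c\<bar> \<le> 27" "coprime c y" "y > 0"
        "real_of_int y \<le> M" "real_of_int \<bar>x\<bar> \<le> 4 * T * real_of_int y"
        unfolding M_def T_def e_def by blast
      define y' where "y' = nat y"
      have y': "y = int y'" "y' > 0" using h(5) by (auto simp: y'_def)
      have eq: "int k * x ^ 3 - c = int m * int (y' ^ 3)" using h(2) by (simp add: y')
      have "\<bar>x\<bar> \<le> int (L y')"
        using h(7) T unfolding L_def y'(1) by (simp add: le_floor_iff)
      hence "x \<in> R c y'" using h(4) eq unfolding R_def y'(1) by simp
      moreover have "c \<in> {-27..27}" using h(3) by auto
      moreover have "y' \<in> {1..nat \<lfloor>M\<rfloor>}" using h(6) y' by (simp add: le_nat_iff le_floor_iff)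
      ultimately have "((c, y'), x) \<in> W" unfolding W_def by simp
      moreover have "m = (\<lambda>((c, y), x). nat ((int k * x ^ 3 - c) div int (y ^ 3))) ((c, y'), x)"
        unfolding prod.case eq using y'(2) by simp
      ultimately show "m \<in> (\<lambda>((c, y), x). nat ((int k * x ^ 3 - c) div int (y ^ 3))) ` W" by (rule rev_image_eqI)
    qed
    hence "card S \<le> card W" using finW by (rule surj_card_le[rotated])
    also have "card W = (\<Sum>c\<in>{-27..27}. \<Sum>y\<in>{1..nat \<lfloor>M\<rfloor>}. card (R c y))"
      unfolding W_def by (subst card_SigmaI) (auto simp: finR sum.cartesian_product case_prod_unfold)
    finally have "real (card S) \<le> real (\<Sum>c\<in>{-27..27}. \<Sum>y\<in>{1..nat \<lfloor>M\<rfloor>}. card (R c y))" by (rule of_nat_mono)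
    also have "\<dots> = (\<Sum>c\<in>{-27..27}. \<Sum>y\<in>{1..nat \<lfloor>M\<rfloor>}. real (card (R c y)))" by simp
    also have "\<dots> \<le> (\<Sum>c\<in>{-27..27::int}. \<Sum>y\<in>{1..nat \<lfloor>M\<rfloor>}. (8 * T / (real y)\<^sup>2 + 1) * (A * M powr \<eta>))"
      by (intro sum_mono cardR)
    also have "\<dots> = 55 * ((8 * T * (\<Sum>y=1..nat \<lfloor>M\<rfloor>. 1 / (real y)\<^sup>2) + real (nat \<lfloor>M\<rfloor>)) * (A * M powr \<eta>))"
      by (simp add: sum.distrib sum_distrib_left sum_distrib_right algebra_simps)
    also have "\<dots> \<le> 55 * ((8 * M * 2 + M) * (A * M powr \<eta>))"
    proof (intro mult_left_mono mult_right_mono add_mono)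
      show "8 * T * (\<Sum>y=1..nat \<lfloor>M\<rfloor>. 1 / (real y)\<^sup>2) \<le> 8 * M * 2"
        using T TM by (intro mult_mono sum_inverse_squares_le sum_nonneg) auto
      show "real (nat \<lfloor>M\<rfloor>) \<le> M" using T TM by auto
    qed (use A in auto)
    also have "\<dots> = 935 * A * (M powr 1 * M powr \<eta>)" using T TM by (simp add: algebra_simps)
    also have "M powr 1 * M powr \<eta> = M powr (1 + \<eta>)" by (simp only: powr_add)
    also have "\<dots> = C powr (1 + \<eta>) * real N powr (1/3 + \<epsilon>)"
      unfolding M_def using C by (simp add: powr_mult powr_powr e\<eta>)
    finally show "real (card S) \<le> 935 * A * C powr (1 + \<eta>) * real N powr (1/3 + \<epsilon>)" by (simp add: mult_ac)
  qed
qed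

theorem theorem1p3:
  fixes \<epsilon> :: real and k :: nat
  assumes "abc_conjecture"
    and "\<epsilon> > 0"
    and "k > 0" and "squarefree k"
  shows "(coprime k 3 \<longrightarrow>
            (\<exists>C::real. C > 0 \<and> (\<forall>N::nat. N \<ge> 1 \<longrightarrow>
               real (card (T_set k \<inter> {1..N})) \<le> C * real N powr (1/3 + \<epsilon>)))) \<and>
         (k \<ge> 2 \<longrightarrow>
            (\<exists>C::real. C > 0 \<and> (\<forall>N::nat. N \<ge> 1 \<longrightarrow>
               real (card (S_set k \<inter> {1..N})) \<le> C * real N powr (1/3 + \<epsilon>))))"
proof -
  obtain C where C: "C \<ge> 1" and size: "\<And>(m::nat) x y c. m > 1 \<Longrightarrow> y > 0 \<Longrightarrow> int k * x ^ 3 - int m * y ^ 3 = c \<Longrightarrow> c dvd 27 \<Longrightarrow>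
    coprime c (int m * y) \<Longrightarrow> real_of_int y \<le> C * real m powr (1/3 + \<epsilon>/2)"
    using abc_imp_thue_solution_bound[OF assms(1-3)] by blast
  obtain B where B: "B > 0" and count: "\<And>(N::nat) S. N \<ge> 1 \<Longrightarrow>
    (\<forall>m\<in>S. \<exists>x y c :: int. m > 0 \<and> int k * x ^ 3 - int m * y ^ 3 = c \<and> \<bar>c\<bar> \<le> 27 \<and> coprime c y \<and> y > 0
       \<and> real_of_int y \<le> C * real N powr (1/3 + \<epsilon>/2) \<and> real_of_int \<bar>x\<bar> \<le> 4 * real N powr (1/3) * real_of_int y) \<Longrightarrow>
    real (card (S :: nat set)) \<le> B * real N powr (1/3 + \<epsilon>)"
    using card_thue_parameters_bound[OF assms(2) C assms(3)] by blast
  have bound: "\<exists>C::real. C > 0 \<and> (\<forall>N::nat. N \<ge> 1 \<longrightarrow> real (card (F \<inter> {1..N})) \<le> C * real N powr (1/3 + \<epsilon>))"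
    if F: "\<And>m. m \<in> F \<Longrightarrow> squarefree m \<and> coprime m k \<and> monogenic (pure_cubic_field (k\<^sup>2 * m)) \<and>
      (k \<ge> 2 \<or> [int (k\<^sup>2 * m) = 1] (mod 9) \<or> [int (k\<^sup>2 * m) = -1] (mod 9))" for F
  proof (intro exI[of _ "B + 1"] conjI allI impI)
    fix N :: nat assume N: "N \<ge> 1"
    \<comment> \<open>The value \<open>m = 1\<close>, where the field is rational if \<open>k = 1\<close>, is absorbed in the constant.\<close>
    have "real (card (F \<inter> {2..N})) \<le> B * real N powr (1/3 + \<epsilon>)"
    proof (rule count[OF N], intro ballI)
      fix m assume m: "m \<in> F \<inter> {2..N}"
      hence m1: "m > 1" "m \<le> N" by auto
      obtain x y c :: int where xyc: "int k * x ^ 3 - int m * y ^ 3 = c" "c dvd 27" "coprime c (int m * y)" "y > 0"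
        using monogenic_pure_cubic_imp_thue[OF assms(4), of m] F[of m] m m1 by blast
      have c: "\<bar>c\<bar> \<le> 27" using dvd_imp_le_int[OF _ xyc(2)] by simp
      have "real_of_int y \<le> C * real m powr (1/3 + \<epsilon>/2)" using size[OF m1(1) xyc(4,1,2,3)] .
      also have "\<dots> \<le> C * real N powr (1/3 + \<epsilon>/2)"
        using C m1 assms(2) by (intro mult_left_mono powr_mono2) auto
      finally have y: "real_of_int y \<le> C * real N powr (1/3 + \<epsilon>/2)" .
      have "real_of_int \<bar>x\<bar> \<le> 4 * real m powr (1/3) * real_of_int y"
        using m1 xyc c assms(3) by (intro thue_solution_size) auto
      also have "\<dots> \<le> 4 * real N powr (1/3) * real_of_int y"
        using m1 xyc(4) by (intro mult_left_mono mult_right_mono powr_mono2) auto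
      finally show "\<exists>x y c :: int. m > 0 \<and> int k * x ^ 3 - int m * y ^ 3 = c \<and> \<bar>c\<bar> \<le> 27 \<and> coprime c y \<and> y > 0
       \<and> real_of_int y \<le> C * real N powr (1/3 + \<epsilon>/2) \<and> real_of_int \<bar>x\<bar> \<le> 4 * real N powr (1/3) * real_of_int y"
        using xyc c y m1 by (intro exI[of _ x] exI[of _ y] exI[of _ c]) auto
    qed
    moreover have "card (F \<inter> {1..N}) \<le> card (insert 1 (F \<inter> {2..N}))"
      by (intro card_mono) auto
    hence "card (F \<inter> {1..N}) \<le> card (F \<inter> {2..N}) + 1" by simp
    moreover have "1 \<le> real N powr (1/3 + \<epsilon>)" using N assms(2) by (intro ge_one_powr_ge_zero) auto
    ultimately show "real (card (F \<inter> {1..N})) \<le> (B + 1) * real N powr (1/3 + \<epsilon>)"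
      by (simp add: distrib_right)
  qed (use B in auto)
  show ?thesis
  proof (intro conjI impI)
    show "\<exists>C::real. C > 0 \<and> (\<forall>N::nat. N \<ge> 1 \<longrightarrow>
               real (card (T_set k \<inter> {1..N})) \<le> C * real N powr (1/3 + \<epsilon>))"
      by (rule bound) (auto simp: T_set_def)
    assume "k \<ge> 2"
    thus "\<exists>C::real. C > 0 \<and> (\<forall>N::nat. N \<ge> 1 \<longrightarrow>
               real (card (S_set k \<inter> {1..N})) \<le> C * real N powr (1/3 + \<epsilon>))"
      by (intro bound) (auto simp: S_set_def)
  qed
qed

end
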